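(* Let all permutation groups be on finite sets. (a) A transitive imprimitive group fails the road closure property. (b) A primitive non-basic group fails the road closure property. (c) A primitive group which has an imprimitive normal subgroup of index $2$ fails the road closure property. (d) For every prime power $q$, the primitive action of $\mathrm{P}\Omega^+(8,q):S_3$ on triples of mutually incident objects consisting of a point and a solid from each of the two families of solids (described in the context) fails the road closure property.
   Context: A transitive permutation group $G$ on a finite set $\Omega$ has the road closure property if for every orbit $O$ of $G$ on $2$-element subsets of $\Omega$, and every maximal block of imprimitivity $B$ for $G$ acting on $O$, the graph with vertex set $\Omega$ and edge set $O\setminus B$ is connected. Here a block of imprimitivity is a nonempty $B\subseteq O$ such that for each $g\in G$ either $Bg=B$ or $Bg\cap B=\emptyset$, and a maximal block is one maximal under inclusion among blocks different from $O$ (possibly a singleton). A transitive group is primitive if it preserves no non-trivial partition of $\Omega$, and imprimitive otherwise. A primitive group is basic if it preserves no non-trivial Cartesian power structure on $\Omega$; that is, it is non-basic if $\Omega$ can be identified with a set $Q^d$ of $d$-tuples over an alphabet $Q$ with $d\ge 2$ and $|Q|\ge 2$, so that $G$ is contained in the wreath product $\mathrm{Sym}(Q)\wr S_d$ in its product action on $Q^d$. The group $\mathrm{P}\Omega^+(8,q)$ acts on the polar space of a hyperbolic quadric in $7$-dimensional projective space over the field of $q$ elements. This polar space has points (totally singular $1$-dimensional subspaces of the $8$-dimensional vector space) and solids (totally singular $4$-dimensional subspaces, i.e. $3$-dimensional projective spaces), the solids falling into two families, with equally many points, solids of the first family and solids of the second family. A point and a solid are incident if the point lies in the solid; two solids from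 different families are incident if they meet in a $3$-dimensional vector subspace (a projective plane). The triality group of outer automorphisms induces $S_3$ on the three types of objects, preserving incidence; $\mathrm{P}\Omega^+(8,q):S_3$ is the resulting extension, acting on the set of triples of mutually incident objects, one of each of the three types. *)

theory Defs
  imports
    "HOL-Analysis.Cartesian_Space"
    "HOL-Library.Numeral_Type"
    "HOL-Library.Disjoint_Sets"
    "HOL-Algebra.Group_Action"
    "HOL-Algebra.Generated_Groups"
begin

section \<open>Permutation groups\<close>

text \<open>
  A permutation group on \<open>\<Omega>\<close> is a set \<open>G\<close> with \<open>subgroup G (BijGroup \<Omega>)\<close>. Its elements are
  extensional functions, i.e. equal to \<open>undefined\<close> outside \<open>\<Omega>\<close>.
\<close>

abbreviation perm_group :: "('a \<Rightarrow> 'a) set \<Rightarrow> 'a set \<Rightarrow> ('a \<Rightarrow> 'a) monoid" where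
  "perm_group G \<Omega> \<equiv> (BijGroup \<Omega>)\<lparr>carrier := G\<rparr>"

definition transitive_on :: "('a \<Rightarrow> 'a) set \<Rightarrow> 'a set \<Rightarrow> bool" where
  "transitive_on G \<Omega> \<longleftrightarrow> transitive_action (perm_group G \<Omega>) \<Omega> (\<lambda>g. g)"

text \<open>The map induced by \<open>g\<close> on a family \<open>\<X>\<close> of subsets of its domain.\<close>

definition set_action :: "'a set set \<Rightarrow> ('a \<Rightarrow> 'a) \<Rightarrow> 'a set \<Rightarrow> 'a set" where
  "set_action \<X> g = (\<lambda>U\<in>\<X>. g ` U)"

subsection \<open>Primitivity\<close>

definition preserves_partition :: "('a \<Rightarrow> 'a) set \<Rightarrow> 'a set set \<Rightarrow> bool" where
  "preserves_partition G P \<longleftrightarrow> (\<forall>g\<in>G. \<forall>C\<in>P. g ` C \<in> P)"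

definition nontrivial_partition :: "'a set \<Rightarrow> 'a set set \<Rightarrow> bool" where
  "nontrivial_partition \<Omega> P \<longleftrightarrow>
     partition_on \<Omega> P \<and> P \<noteq> {\<Omega>} \<and> P \<noteq> (\<lambda>x. {x}) ` \<Omega>"

definition primitive_on :: "('a \<Rightarrow> 'a) set \<Rightarrow> 'a set \<Rightarrow> bool" where
  "primitive_on G \<Omega> \<longleftrightarrow> transitive_on G \<Omega> \<and>
     \<not> (\<exists>P. nontrivial_partition \<Omega> P \<and> preserves_partition G P)"

definition imprimitive_on :: "('a \<Rightarrow> 'a) set \<Rightarrow> 'a set \<Rightarrow> bool" where
  "imprimitive_on G \<Omega> \<longleftrightarrow> transitive_on G \<Omega> \<and> \<not> primitive_on G \<Omega>"

subsection \<open>Cartesian power structures\<close>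

text \<open>
  \<open>Sym(Q) wr S\<^sub>d\<close> in its product action: the coordinates of a tuple in \<open>Q\<^sup>d\<close> are permuted
  by \<open>\<sigma>\<close>, and then the \<open>i\<close>-th one is changed by \<open>h i\<close>.
\<close>

definition wreath_product_action :: "'q set \<Rightarrow> nat \<Rightarrow> ((nat \<Rightarrow> 'q) \<Rightarrow> nat \<Rightarrow> 'q) set" where
  "wreath_product_action Q d =
     {\<lambda>x \<in> ({..<d} \<rightarrow>\<^sub>E Q). \<lambda>i\<in>{..<d}. h i (x (\<sigma> i)) | h \<sigma>.
        (\<forall>i<d. h i \<in> Bij Q) \<and> \<sigma> \<in> Bij {..<d}}"

text \<open>
  The permuted set is finite, so an alphabet may always be taken to be a set of natural numbers.
\<close>

definition preserves_cartesian_power :: "('a \<Rightarrow> 'a) set \<Rightarrow> 'a set \<Rightarrow> bool" where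
  "preserves_cartesian_power G \<Omega> \<longleftrightarrow>
     (\<exists>(Q :: nat set) d f. finite Q \<and> card Q \<ge> 2 \<and> d \<ge> 2 \<and>
        bij_betw f \<Omega> ({..<d} \<rightarrow>\<^sub>E Q) \<and>
        (\<forall>g\<in>G. \<exists>w \<in> wreath_product_action Q d. \<forall>x\<in>\<Omega>. f (g x) = w (f x)))"

definition basic_on :: "('a \<Rightarrow> 'a) set \<Rightarrow> 'a set \<Rightarrow> bool" where
  "basic_on G \<Omega> \<longleftrightarrow> primitive_on G \<Omega> \<and> \<not> preserves_cartesian_power G \<Omega>"

subsection \<open>The road closure property\<close>

definition two_subsets :: "'a set \<Rightarrow> 'a set set" where
  "two_subsets \<Omega> = {e. e \<subseteq> \<Omega> \<and> card e = 2}"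

definition edge_orbits :: "('a \<Rightarrow> 'a) set \<Rightarrow> 'a set \<Rightarrow> 'a set set set" where
  "edge_orbits G \<Omega> = orbits (perm_group G \<Omega>) (two_subsets \<Omega>) (set_action (two_subsets \<Omega>))"

definition block_on :: "('a \<Rightarrow> 'a) set \<Rightarrow> 'a set set \<Rightarrow> 'a set set \<Rightarrow> bool" where
  "block_on G E B \<longleftrightarrow> B \<noteq> {} \<and> B \<subseteq> E \<and>
     (\<forall>g\<in>G. set_action E g ` B = B \<or> set_action E g ` B \<inter> B = {})"

definition maximal_block_on :: "('a \<Rightarrow> 'a) set \<Rightarrow> 'a set set \<Rightarrow> 'a set set \<Rightarrow> bool" where
  "maximal_block_on G E B \<longleftrightarrow> block_on G E B \<and> B \<noteq> E \<and>
     (\<forall>C. block_on G E C \<and> C \<noteq> E \<and> B \<subseteq> C \<longrightarrow> C = B)"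

definition graph_connected :: "'a set \<Rightarrow> 'a set set \<Rightarrow> bool" where
  "graph_connected V E \<longleftrightarrow> (\<forall>u\<in>V. \<forall>v\<in>V. (u, v) \<in> {(x, y). {x, y} \<in> E}\<^sup>*)"

text \<open>
  The property is meant for transitive groups. Transitivity is not part of the definition, so that
  the negation of the property says that some graph \<open>E - B\<close> is disconnected.
\<close>

definition road_closure_property :: "('a \<Rightarrow> 'a) set \<Rightarrow> 'a set \<Rightarrow> bool" where
  "road_closure_property G \<Omega> \<longleftrightarrow>
     (\<forall>E \<in> edge_orbits G \<Omega>. \<forall>B. maximal_block_on G E B \<longrightarrow> graph_connected \<Omega> (E - B))"

section \<open>The hyperbolic quadric in 7-dimensional projective space\<close>

text \<open>
  The field of \<open>q\<close> elements is a type \<open>'k\<close> of sorts \<open>field\<close> and \<open>finite\<close>; thus \<open>q = CARD('k)\<close>.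
\<close>

definition hyperbolic_form :: "'k::{field,finite} ^ 8 \<Rightarrow> 'k" where
  "hyperbolic_form v = v$0 * v$1 + v$2 * v$3 + v$4 * v$5 + v$6 * v$7"

definition orthogonal_group :: "('k::{field,finite} ^ 8 \<Rightarrow> 'k ^ 8) set" where
  "orthogonal_group = {g. Vector_Spaces.linear (*s) (*s) g \<and> bij g \<and>
     (\<forall>v. hyperbolic_form (g v) = hyperbolic_form v)}"

definition Omega_plus :: "('k::{field,finite} ^ 8 \<Rightarrow> 'k ^ 8) set" where
  "Omega_plus = derived (BijGroup UNIV) orthogonal_group"

definition totally_singular :: "('k::{field,finite} ^ 8) set \<Rightarrow> bool" where
  "totally_singular U \<longleftrightarrow> vec.subspace U \<and> (\<forall>v\<in>U. hyperbolic_form v = 0)"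

definition polar_points :: "('k::{field,finite} ^ 8) set set" where
  "polar_points = {U. totally_singular U \<and> vec.dim U = 1}"

definition solids :: "('k::{field,finite} ^ 8) set set" where
  "solids = {U. totally_singular U \<and> vec.dim U = 4}"

text \<open>
  Two solids belong to the same family iff their intersection has even vector space dimension.
\<close>

definition same_family :: "(('k::{field,finite} ^ 8) set \<times> ('k ^ 8) set) set" where
  "same_family = {(S, S'). S \<in> solids \<and> S' \<in> solids \<and> even (vec.dim (S \<inter> S'))}"

definition objects :: "('k::{field,finite} ^ 8) set set" where
  "objects = polar_points \<union> solids"

definition object_types :: "('k::{field,finite} ^ 8) set set set" where
  "object_types = insert polar_points (solids // same_family)"

definition incident :: "('k::{field,finite} ^ 8) set \<Rightarrow> ('k ^ 8) set \<Rightarrow> bool" where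
  "incident X Y \<longleftrightarrow>
     X \<in> polar_points \<and> Y \<in> solids \<and> X \<subseteq> Y \<or>
     X \<in> solids \<and> Y \<in> polar_points \<and> Y \<subseteq> X \<or>
     X \<in> solids \<and> Y \<in> solids \<and> (X, Y) \<notin> same_family \<and> vec.dim (X \<inter> Y) = 3"

text \<open>
  A triple is encoded as an unordered set, because triality permutes the three types.
\<close>

definition incident_triples :: "('k::{field,finite} ^ 8) set set set" where
  "incident_triples =
     {t. t \<subseteq> objects \<and> (\<forall>\<tau>\<in>object_types. card (t \<inter> \<tau>) = 1) \<and> pairwise incident t}"

text \<open>
  The scalars in \<open>Omega_plus\<close> are its elements that fix all objects, so the permutation group
  induced on the objects is the quotient of \<open>Omega_plus\<close> by its scalars.
\<close>

definition POmega_plus :: "(('k::{field,finite} ^ 8) set \<Rightarrow> ('k ^ 8) set) set" where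
  "POmega_plus = set_action objects ` Omega_plus"

text \<open>
  A triality group is a group of incidence-preserving permutations of the objects that acts on
  \<open>POmega_plus\<close> by conjugation and on the three types as their full symmetric group,
  the latter faithfully (the map to \<open>BijGroup object_types\<close> is an isomorphism). There can be
  several such groups, differing for instance by field automorphisms.
\<close>

definition triality_group :: "(('k::{field,finite} ^ 8) set \<Rightarrow> ('k ^ 8) set) set \<Rightarrow> bool" where
  "triality_group T \<longleftrightarrow>
     subgroup T (BijGroup objects) \<and>
     (\<forall>t\<in>T. \<forall>X\<in>objects. \<forall>Y\<in>objects. incident (t X) (t Y) \<longleftrightarrow> incident X Y) \<and>
     T \<subseteq> normalizer (BijGroup objects) POmega_plus \<and>
     set_action object_types \<in> iso (perm_group T objects) (BijGroup object_types)"

definition POmega_plus_ext ::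
    "(('k::{field,finite} ^ 8) set \<Rightarrow> ('k ^ 8) set) set \<Rightarrow> (('k ^ 8) set \<Rightarrow> ('k ^ 8) set) set" where
  "POmega_plus_ext T = POmega_plus <#>\<^bsub>BijGroup objects\<^esub> T"

end

theory Submission
  imports Defs "HOL-Algebra.Zassenhaus"
begin

text \<open>
  A graph is disconnected as soon as all its edges stay inside the parts of a partition with
  at least two parts. Every failure of road closure below has this cause. A group need only be
  shown to have some proper block of an edge orbit whose removal leaves a disconnected graph: a
  maximal block that contains it leaves even fewer edges (\<open>not_road_closure_if_block\<close>).

  For a transitive imprimitive group the orbit of an edge inside a part is itself disconnected.
  The other three classes are instances of one configuration
  (\<open>not_road_closure_if_split_once\<close>): the group \<open>G\<close> permutes a family of partitions
  of the point set, an edge \<open>e\<close> joins different parts of exactly one member \<open>P\<close> of the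
  family, and \<open>G\<close> does not fix \<open>P\<close>. Then every edge of the orbit of \<open>e\<close> is split by
  exactly one member of the family. The edges of the orbit that are split by \<open>P\<close> form a block
  \<open>B\<close>, because an element of \<open>G\<close> that fixes \<open>P\<close> preserves \<open>B\<close> and any other element takes
  \<open>B\<close> to edges that only another member splits. Since \<open>P\<close> is moved, \<open>B\<close> is not the whole
  orbit; and no edge outside \<open>B\<close> leaves a part of \<open>P\<close>.

  \<^item> For a Cartesian power, the family consists of the partitions by the value of one
    coordinate, and \<open>e\<close> is a pair of tuples that differ in one coordinate.
  \<^item> For an imprimitive normal subgroup of index 2 with invariant partition \<open>P\<close>, the family
    consists of \<open>P\<close> and its one other image \<open>g P\<close> under the primitive group, and \<open>e\<close> lies in
    a part of \<open>g P\<close>. It is split by \<open>P\<close>, since the common refinement of the two partitions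
    is invariant under the primitive group and therefore consists of singletons
    (\<open>primitive_family_splits\<close>).
  \<^item> For triality, the family consists of the partitions of the triples by their object of one
    type, and \<open>e\<close> is a pair of triples that share both solids. The group permutes the three
    types as \<open>S\<^sub>3\<close>, so it does not fix the partition by points.

  What is particular to the quadric is the existence of such a pair of triples. Two coordinate
  solids that meet in a plane are used. They represent both families of solids because every
  solid meets one of the two in exactly one dimension more than it meets their common plane
  (\<open>solid_meets_one_more\<close>), which follows from the bound on the dimension of an orthogonal
  space for the polarization of the quadratic form (\<open>dim_perp_le\<close>).
\<close>

section \<open>Permutation groups\<close>

lemma perm_group_bij:
  assumes "subgroup G (BijGroup \<Omega>)" "g \<in> G"
  shows "bij_betw g \<Omega> \<Omega>"
  using subgroup.subset[OF assms(1)] assms(2) by (auto simp: BijGroup_def Bij_def)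

lemma perm_group_image_subset:
  assumes "subgroup G (BijGroup \<Omega>)" "g \<in> G" "A \<subseteq> \<Omega>"
  shows "g ` A \<subseteq> \<Omega>"
  using perm_group_bij[OF assms(1,2)] assms(3) by (auto simp: bij_betw_def)

lemma perm_group_image_subset_iff:
  assumes "subgroup G (BijGroup \<Omega>)" "g \<in> G" "A \<subseteq> \<Omega>" "B \<subseteq> \<Omega>"
  shows "g ` A \<subseteq> g ` B \<longleftrightarrow> A \<subseteq> B"
  using perm_group_bij[OF assms(1,2)] assms(3,4)
  unfolding bij_betw_def by (metis image_mono inj_on_image_mem_iff subset_iff image_subset_iff)

lemma perm_group_two_subsets:
  assumes "subgroup G (BijGroup \<Omega>)" "g \<in> G" "e \<in> two_subsets \<Omega>"
  shows "g ` e \<in> two_subsets \<Omega>"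
  using perm_group_bij[OF assms(1,2)] assms(3) perm_group_image_subset[OF assms(1,2)]
  by (auto simp: two_subsets_def bij_betw_def card_image inj_on_subset)

lemma perm_group_id:
  assumes "subgroup G (BijGroup \<Omega>)"
  shows "(\<lambda>x\<in>\<Omega>. x) \<in> G"
  using subgroup.one_closed[OF assms] by (simp add: BijGroup_def)

lemma perm_group_compose:
  assumes "subgroup G (BijGroup \<Omega>)" "g \<in> G" "h \<in> G"
  shows "compose \<Omega> g h \<in> G"
  using subgroup.m_closed[OF assms] subgroup.subset[OF assms(1)] assms(2,3)
  by (auto simp: BijGroup_def subset_iff)

lemma perm_group_inverse:
  assumes "subgroup G (BijGroup \<Omega>)" "g \<in> G"
  shows "(\<lambda>x\<in>\<Omega>. inv_into \<Omega> g x) \<in> G"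
proof -
  have "g \<in> Bij \<Omega>" using subgroup.subset[OF assms(1)] assms(2) by (auto simp: BijGroup_def)
  then show ?thesis using subgroup.m_inv_closed[OF assms] by (simp only: inv_BijGroup)
qed

lemma image_compose_on: "A \<subseteq> \<Omega> \<Longrightarrow> compose \<Omega> g h ` A = g ` h ` A"
  by (force simp: compose_def)

lemma image_compose_on_family:
  assumes "\<And>A. A \<in> \<A> \<Longrightarrow> A \<subseteq> \<Omega>"
  shows "(`) (compose \<Omega> g h) ` \<A> = (`) g ` (`) h ` \<A>"
  unfolding image_image[of "(`) g"] by (rule image_cong[OF refl]) (rule image_compose_on[OF assms])

lemma transitive_onE:
  assumes "transitive_on G \<Omega>" "x \<in> \<Omega>" "y \<in> \<Omega>"
  obtains g where "g \<in> G" "g x = y"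
proof -
  interpret transitive_action "perm_group G \<Omega>" \<Omega> "\<lambda>g. g"
    using assms(1) unfolding transitive_on_def .
  show thesis using unique_orbit[OF assms(2,3)] that by auto
qed

section \<open>Partitions and the pairs they split\<close>

text \<open>
  The parts of a partition are treated as cells that an edge either stays in or leaves; the edges
  that leave their cell are the ones that matter for connectedness.
\<close>

definition splits :: "'a set set \<Rightarrow> 'a set \<Rightarrow> bool" where
  "splits P e \<longleftrightarrow> \<not> (\<exists>C\<in>P. e \<subseteq> C)"

lemma unsplit_graph_disconnected:
  assumes P: "partition_on \<Omega> P" and "x \<in> \<Omega>" "y \<in> \<Omega>" "splits P {x, y}"
    and E: "\<And>e. e \<in> E \<Longrightarrow> \<not> splits P e"
  shows "\<not> graph_connected \<Omega> E"
proof
  assume "graph_connected \<Omega> E"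
  then have "(x, y) \<in> {(x, y). {x, y} \<in> E}\<^sup>*"
    using assms(2,3) by (auto simp: graph_connected_def)
  moreover obtain C where C: "C \<in> P" "x \<in> C" using assms(2) partition_onD1[OF P] by auto
  ultimately have "y \<in> C"
  proof (induction rule: rtrancl_induct)
    case (step u v)
    then obtain D where "D \<in> P" "{u, v} \<subseteq> D" using E by (fastforce simp: splits_def)
    moreover have "u \<in> C" using step by blast
    ultimately have "D = C" using C(1) partition_onD2[OF P] by (auto dest: disjointD)
    then show ?case using \<open>{u, v} \<subseteq> D\<close> by simp
  qed
  then show False using C assms(4) by (auto simp: splits_def)
qed

text \<open>
  The partitions built below record the value of a function: one coordinate of a tuple, the
  object of a given type in a triple, or the set of those parts that contain a point.
\<close>

definition fibres :: "'a set \<Rightarrow> ('a \<Rightarrow> 'b) \<Rightarrow> 'a set set" where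
  "fibres \<Omega> F = (\<lambda>x. {y\<in>\<Omega>. F y = F x}) ` \<Omega>"

lemma partition_on_fibres: "partition_on \<Omega> (fibres \<Omega> F)"
  by (rule partition_onI) (auto simp: fibres_def disjnt_def)

lemma splits_fibres:
  assumes "x \<in> \<Omega>" "y \<in> \<Omega>"
  shows "splits (fibres \<Omega> F) {x, y} \<longleftrightarrow> F x \<noteq> F y"
  using assms by (auto simp: splits_def fibres_def)

lemma image_fibres:
  assumes bij: "bij_betw g \<Omega> \<Omega>"
    and "\<And>x y. x \<in> \<Omega> \<Longrightarrow> y \<in> \<Omega> \<Longrightarrow> F' (g x) = F' (g y) \<longleftrightarrow> F x = F y"
  shows "(`) g ` fibres \<Omega> F = fibres \<Omega> F'"
proof -
  have "g ` {y\<in>\<Omega>. F y = F x} = {z\<in>\<Omega>. F' z = F' (g x)}" if "x \<in> \<Omega>" for x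
  proof (intro equalityI subsetI)
    fix z assume z: "z \<in> {z\<in>\<Omega>. F' z = F' (g x)}"
    then obtain y where "y \<in> \<Omega>" "z = g y" using bij by (auto simp: bij_betw_def)
    then show "z \<in> g ` {y\<in>\<Omega>. F y = F x}" using z that assms(2) by auto
  qed (use that assms in \<open>auto simp: bij_betw_def\<close>)
  then have "(`) g ` fibres \<Omega> F = (\<lambda>x. {z\<in>\<Omega>. F' z = F' (g x)}) ` \<Omega>"
    unfolding fibres_def image_image by (rule image_cong[OF refl])
  also have "\<dots> = (\<lambda>x. {z\<in>\<Omega>. F' z = F' x}) ` g ` \<Omega>" by (simp add: image_image)
  also have "\<dots> = fibres \<Omega> F'" using bij by (simp add: fibres_def bij_betw_def)
  finally show ?thesis .
qed

text \<open>
  The two ways of being trivial are excluded separately: a partition other than the whole set has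
  points in different parts, and one other than the singletons has an edge inside a part.
\<close>

lemma nontrivial_partition_split:
  assumes "nontrivial_partition \<Omega> P"
  obtains x y where "x \<in> \<Omega>" "y \<in> \<Omega>" "splits P {x, y}"
proof -
  have P: "partition_on \<Omega> P" "P \<noteq> {\<Omega>}" "P \<noteq> (\<lambda>x. {x}) ` \<Omega>"
    using assms by (auto simp: nontrivial_partition_def)
  have "P \<noteq> {}" using P partition_onD1[OF P(1)] by auto
  then obtain C where C: "C \<in> P" by auto
  have "\<exists>D\<in>P. D \<noteq> C"
  proof (rule ccontr)
    assume "\<not> ?thesis"
    then have "P = {C}" using C by blast
    moreover from this have "\<Omega> = C" using partition_onD1[OF P(1)] by simp
    ultimately show False using P(2) by simp
  qed
  then obtain D where D: "D \<in> P" "D \<noteq> C" by auto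
  obtain x where x: "x \<in> C" using C partition_onD3[OF P(1)] by fastforce
  obtain y where y: "y \<in> D" using D partition_onD3[OF P(1)] by fastforce
  have "C \<inter> D = {}" using C D partition_onD2[OF P(1)] by (auto dest: disjointD)
  have "splits P {x, y}"
    unfolding splits_def
  proof
    assume "\<exists>F\<in>P. {x, y} \<subseteq> F"
    then obtain F where "F \<in> P" "x \<in> F" "y \<in> F" by auto
    then have "F = C" "F = D" using x y C D partition_onD2[OF P(1)] by (auto dest: disjointD)
    then show False using D by simp
  qed
  moreover have "x \<in> \<Omega>" "y \<in> \<Omega>" using x y C D partition_onD1[OF P(1)] by auto
  ultimately show thesis using that by blast
qed

lemma nontrivial_partition_edge:
  assumes "nontrivial_partition \<Omega> P"
  obtains e where "e \<in> two_subsets \<Omega>" "\<not> splits P e"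
proof -
  have P: "partition_on \<Omega> P" "P \<noteq> (\<lambda>x. {x}) ` \<Omega>"
    using assms by (auto simp: nontrivial_partition_def)
  have "\<exists>C\<in>P. \<exists>x\<in>C. \<exists>y\<in>C. x \<noteq> y"
  proof (rule ccontr)
    assume "\<not> ?thesis"
    then have single: "C = {x}" if "C \<in> P" "x \<in> C" for C x using that by blast
    have "P = (\<lambda>x. {x}) ` \<Omega>"
    proof (intro equalityI subsetI)
      fix C assume C: "C \<in> P"
      then obtain x where "x \<in> C" using partition_onD3[OF P(1)] by fastforce
      then show "C \<in> (\<lambda>x. {x}) ` \<Omega>" using single[OF C] C partition_onD1[OF P(1)] by auto
    next
      fix C assume "C \<in> (\<lambda>x. {x}) ` \<Omega>"
      then obtain x D where "C = {x}" "x \<in> D" "D \<in> P" using partition_onD1[OF P(1)] by auto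
      then show "C \<in> P" using single by metis
    qed
    then show False using P by simp
  qed
  then obtain C x y where C: "C \<in> P" "x \<in> C" "y \<in> C" "x \<noteq> y" by blast
  have "{x, y} \<in> two_subsets \<Omega>"
    using C partition_onD1[OF P(1)] by (auto simp: two_subsets_def card_2_iff)
  moreover have "\<not> splits P {x, y}" using C by (auto simp: splits_def)
  ultimately show thesis using that by blast
qed

lemma splits_image:
  assumes "subgroup G (BijGroup \<Omega>)" "g \<in> G" "partition_on \<Omega> P" "e \<subseteq> \<Omega>"
  shows "splits ((`) g ` P) (g ` e) \<longleftrightarrow> splits P e"
proof -
  have "C \<subseteq> \<Omega>" if "C \<in> P" for C using that partition_onD1[OF assms(3)] by auto
  then show ?thesis unfolding splits_def
    using perm_group_image_subset_iff[OF assms(1,2,4)] by auto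
qed

text \<open>
  Invariance is defined by inclusion; on a finite set an injective map of the parts into
  themselves permutes them.
\<close>

lemma preserves_partition_image:
  assumes "finite \<Omega>" "subgroup G (BijGroup \<Omega>)" "partition_on \<Omega> P" "preserves_partition G P" "g \<in> G"
  shows "(`) g ` P = P"
proof (rule endo_inj_surj)
  show "finite P" using finite_elements assms(1,3) .
  show "(`) g ` P \<subseteq> P" using assms(4,5) by (auto simp: preserves_partition_def)
  show "inj_on ((`) g) P"
    by (rule inj_on_subset[OF inj_on_image_Pow])
      (use perm_group_bij[OF assms(2,5)] partition_onD1[OF assms(3)] in \<open>auto simp: bij_betw_def\<close>)
qed

section \<open>A criterion for failure of road closure\<close>

text \<open>
  The orbit of one edge without the restriction of the action to the set of all edges, which
  makes no difference for an edge.
\<close>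

definition edge_orbit :: "('a \<Rightarrow> 'a) set \<Rightarrow> 'a set \<Rightarrow> 'a set set" where
  "edge_orbit G e = (\<lambda>g. g ` e) ` G"

lemma edge_orbit_in_edge_orbits:
  assumes "e \<in> two_subsets \<Omega>"
  shows "edge_orbit G e \<in> edge_orbits G \<Omega>"
proof -
  have "orbit (perm_group G \<Omega>) (set_action (two_subsets \<Omega>)) e = edge_orbit G e"
    using assms by (auto simp: orbit_def edge_orbit_def set_action_def)
  then show ?thesis using assms by (auto simp: edge_orbits_def orbits_def)
qed

lemma edge_orbit_self:
  assumes "subgroup G (BijGroup \<Omega>)" "e \<subseteq> \<Omega>"
  shows "e \<in> edge_orbit G e"
proof -
  have "(\<lambda>x\<in>\<Omega>. x) ` e = e" using assms(2) by force
  then show ?thesis unfolding edge_orbit_def using perm_group_id[OF assms(1)] by (metis imageI)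
qed

lemma edge_orbit_closed:
  assumes "subgroup G (BijGroup \<Omega>)" "e \<subseteq> \<Omega>" "g \<in> G" "c \<in> edge_orbit G e"
  shows "g ` c \<in> edge_orbit G e"
proof -
  obtain h where h: "h \<in> G" "c = h ` e" using assms(4) by (auto simp: edge_orbit_def)
  then have "g ` c = compose \<Omega> g h ` e" using image_compose_on[OF assms(2)] by metis
  then show ?thesis unfolding edge_orbit_def using perm_group_compose[OF assms(1,3) h(1)] by blast
qed

text \<open>
  A proper block of a finite orbit lies in a maximal one, and removing more edges cannot reconnect
  a graph.
\<close>

lemma not_road_closure_if_block:
  assumes "E \<in> edge_orbits G \<Omega>" "finite E" "block_on G E B" "B \<noteq> E"
    and "\<not> graph_connected \<Omega> (E - B)"
  shows "\<not> road_closure_property G \<Omega>"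
proof -
  let ?\<B> = "{C. block_on G E C \<and> C \<noteq> E}"
  have "finite ?\<B>" by (rule finite_subset[of _ "Pow E"]) (use assms(2) in \<open>auto simp: block_on_def\<close>)
  then obtain M where M: "M \<in> ?\<B>" "B \<subseteq> M" "\<And>C. C \<in> ?\<B> \<Longrightarrow> M \<subseteq> C \<Longrightarrow> M = C"
    using finite_has_maximal2[of ?\<B> B] assms(3,4) by auto
  then have "maximal_block_on G E M" by (auto simp: maximal_block_on_def)
  moreover have "\<not> graph_connected \<Omega> (E - M)"
  proof
    assume "graph_connected \<Omega> (E - M)"
    moreover have "{(x, y). {x, y} \<in> E - M}\<^sup>* \<subseteq> {(x, y). {x, y} \<in> E - B}\<^sup>*"
      by (rule rtrancl_mono) (use M(2) in auto)
    ultimately show False using assms(5) unfolding graph_connected_def by blast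
  qed
  ultimately show ?thesis using assms(1) by (auto simp: road_closure_property_def)
qed

lemma finite_edge_orbit:
  assumes "finite \<Omega>" "subgroup G (BijGroup \<Omega>)" "e \<subseteq> \<Omega>"
  shows "finite (edge_orbit G e)"
  by (rule finite_subset[of _ "Pow \<Omega>"])
    (use assms perm_group_image_subset[OF assms(2) _ assms(3)] in \<open>auto simp: edge_orbit_def\<close>)

lemma two_subsetsE:
  assumes "e \<in> two_subsets \<Omega>"
  obtains x y where "e = {x, y}" "x \<in> \<Omega>" "y \<in> \<Omega>" "x \<noteq> y"
  using assms by (auto simp: two_subsets_def card_2_iff)

text \<open>
  The common mechanism. The group acts on pairs of an edge in the orbit and the unique member of
  \<open>\<P>\<close> that splits it, so the orbit is fibred over the orbit of \<open>P\<close> in \<open>\<P>\<close>, and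
  the fibres are blocks.
\<close>

proposition not_road_closure_if_split_once:
  assumes "finite \<Omega>" and G: "subgroup G (BijGroup \<Omega>)"
    and parts: "\<And>P. P \<in> \<P> \<Longrightarrow> partition_on \<Omega> P"
    and invariant: "\<And>g P. g \<in> G \<Longrightarrow> P \<in> \<P> \<Longrightarrow> (`) g ` P \<in> \<P>"
    and e: "e \<in> two_subsets \<Omega>"
    and P: "P \<in> \<P>" "splits P e" "\<And>P'. P' \<in> \<P> \<Longrightarrow> splits P' e \<Longrightarrow> P' = P"
    and moved: "g0 \<in> G" "(`) g0 ` P \<noteq> P"
  shows "\<not> road_closure_property G \<Omega>"
proof -
  define E where "E = edge_orbit G e"
  define B where "B = {c \<in> E. splits P c}"
  have e\<Omega>: "e \<subseteq> \<Omega>" using e by (simp add: two_subsets_def)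
  have E\<Omega>: "c \<subseteq> \<Omega>" if "c \<in> E" for c
    using that perm_group_image_subset[OF G _ e\<Omega>] by (auto simp: E_def edge_orbit_def)
  have "finite E" unfolding E_def by (rule finite_edge_orbit) fact+
  have closed: "g ` c \<in> E" if "g \<in> G" "c \<in> E" for g c
    using that edge_orbit_closed[OF G e\<Omega>] by (simp add: E_def)
  \<comment> \<open>Moving an edge of the orbit back to e turns every member of the family that splits it into P.\<close>
  have once: "P1 = P2" if c: "c \<in> E" and "P1 \<in> \<P>" "P2 \<in> \<P>" "splits P1 c" "splits P2 c" for c P1 P2
  proof -
    obtain g where g: "g \<in> G" "c = g ` e" using c by (auto simp: E_def edge_orbit_def)
    define h where "h = (\<lambda>x\<in>\<Omega>. inv_into \<Omega> g x)"
    have h: "h \<in> G" unfolding h_def by (rule perm_group_inverse[OF G g(1)])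
    have bij: "bij_betw g \<Omega> \<Omega>" by (rule perm_group_bij[OF G g(1)])
    have "h (g x) = x" if "x \<in> \<Omega>" for x
      using bij that by (auto simp: h_def bij_betw_def inv_into_f_f)
    then have he: "h ` c = e" using e\<Omega> g(2) by (force simp: image_image)
    have gh: "g (h x) = x" if "x \<in> \<Omega>" for x
      using bij that by (auto simp: h_def bij_betw_def f_inv_into_f)
    have roundtrip: "(`) g ` (`) h ` Q = Q" if "Q \<in> \<P>" for Q
    proof -
      have "g ` h ` A = A" if "A \<in> Q" for A
      proof -
        have "A \<subseteq> \<Omega>" using that \<open>Q \<in> \<P>\<close> parts partition_onD1 by blast
        then show ?thesis using gh by (force simp: image_image)
      qed
      then show ?thesis by (simp add: image_image)
    qed
    have "(`) h ` Q = P" if "Q \<in> \<P>" "splits Q c" for Q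
      using splits_image[OF G h parts[OF that(1)] E\<Omega>[OF c]] that he P(3) invariant[OF h] by auto
    then show ?thesis using roundtrip that by metis
  qed
  \<comment> \<open>One inclusion suffices, since B is finite and g acts injectively on it.\<close>
  have image_B: "(`) g ` B \<subseteq> B" if g: "g \<in> G" and "(`) g ` P = P" for g
    using splits_image[OF G g parts[OF P(1)]] E\<Omega> closed[OF g] that(2) by (auto simp: B_def)
  have "block_on G E B"
    unfolding block_on_def
  proof (intro conjI ballI)
    show "B \<noteq> {}" using P(2) edge_orbit_self[OF G e\<Omega>] by (auto simp: B_def E_def)
    show "B \<subseteq> E" by (auto simp: B_def)
    fix g assume g: "g \<in> G"
    have act: "set_action E g ` B = (`) g ` B" by (auto simp: set_action_def B_def)
    show "set_action E g ` B = B \<or> set_action E g ` B \<inter> B = {}"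
    proof (cases "(`) g ` P = P")
      case True
      have "inj_on ((`) g) B"
        by (rule inj_on_subset[OF inj_on_image_Pow])
          (use perm_group_bij[OF G g] E\<Omega> in \<open>auto simp: bij_betw_def B_def\<close>)
      then have "(`) g ` B = B"
        using image_B[OF g True] \<open>finite E\<close> by (intro endo_inj_surj) (auto simp: B_def)
      then show ?thesis using act by simp
    next
      case False
      have "g ` c \<notin> B" if "c \<in> B" for c
      proof
        assume "g ` c \<in> B"
        moreover have "splits ((`) g ` P) (g ` c)"
          using that splits_image[OF G g parts[OF P(1)]] E\<Omega> by (auto simp: B_def)
        ultimately show False
          using False once[of "g ` c" P "(`) g ` P"] P(1) invariant[OF g P(1)] by (auto simp: B_def)
      qed
      then show ?thesis using act by auto
    qed
  qed
  moreover have "B \<noteq> E"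
  proof
    assume "B = E"
    then have "splits P (g0 ` e)"
      using closed[OF moved(1)] edge_orbit_self[OF G e\<Omega>] by (auto simp: B_def E_def)
    moreover have "splits ((`) g0 ` P) (g0 ` e)"
      using splits_image[OF G moved(1) parts[OF P(1)] e\<Omega>] P(2) by simp
    ultimately show False
      using once[of "g0 ` e"] moved invariant[OF moved(1) P(1)] P(1) closed[OF moved(1)]
        edge_orbit_self[OF G e\<Omega>] by (auto simp: E_def)
  qed
  moreover have "\<not> graph_connected \<Omega> (E - B)"
  proof -
    obtain x y where "e = {x, y}" "x \<in> \<Omega>" "y \<in> \<Omega>" using e by (rule two_subsetsE)
    then show ?thesis
      using P(1,2) parts by (intro unsplit_graph_disconnected[of \<Omega> P x y]) (auto simp: B_def)
  qed
  ultimately show ?thesis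
    using edge_orbit_in_edge_orbits[OF e] \<open>finite E\<close> unfolding E_def
    by (intro not_road_closure_if_block)
qed

section \<open>Imprimitive groups\<close>

text \<open>
  The whole orbit of an edge inside a part is already disconnected, whatever block is removed. The
  only point is that the orbit has a proper block, because an orbit that consists of one edge has
  none.
\<close>

proposition imprimitive_not_road_closure:
  assumes fin: "finite \<Omega>" and G: "subgroup G (BijGroup \<Omega>)" and "imprimitive_on G \<Omega>"
  shows "\<not> road_closure_property G \<Omega>"
proof -
  obtain P where P: "nontrivial_partition \<Omega> P" "preserves_partition G P" and tr: "transitive_on G \<Omega>"
    using assms(3) by (auto simp: imprimitive_on_def primitive_on_def)
  have part: "partition_on \<Omega> P" using P(1) by (simp add: nontrivial_partition_def)
  obtain x y where xy: "x \<in> \<Omega>" "y \<in> \<Omega>" "splits P {x, y}" using nontrivial_partition_split[OF P(1)] .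
  obtain e where e: "e \<in> two_subsets \<Omega>" "\<not> splits P e" using nontrivial_partition_edge[OF P(1)] .
  have e\<Omega>: "e \<subseteq> \<Omega>" using e by (simp add: two_subsets_def)
  have unsplit: "\<not> splits P c" if c: "c \<in> edge_orbit G e" for c
  proof -
    obtain g where g: "g \<in> G" "c = g ` e" using c by (auto simp: edge_orbit_def)
    then show ?thesis
      using splits_image[OF G g(1) part e\<Omega>] preserves_partition_image[OF fin G part P(2) g(1)] e(2)
      by simp
  qed
  obtain a where a: "a \<in> e" "a \<in> \<Omega>" using e(1) by (auto elim: two_subsetsE)
  \<comment> \<open>If e were its own orbit, it would contain both x and y by transitivity, although it lies in one
    part and they do not. So the singleton of e is a proper block.\<close>
  have "\<exists>c\<in>edge_orbit G e. c \<noteq> e"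
  proof -
    obtain g h where g: "g \<in> G" "g a = x" and h: "h \<in> G" "h a = y"
      using transitive_onE[OF tr a(2)] xy by metis
    have gh: "g ` e \<in> edge_orbit G e" "h ` e \<in> edge_orbit G e" using g h by (auto simp: edge_orbit_def)
    moreover have "\<not> (g ` e = e \<and> h ` e = e)"
    proof
      assume "g ` e = e \<and> h ` e = e"
      then have "{x, y} \<subseteq> e" using g h a by blast
      then show False using e(2) xy(3) by (auto simp: splits_def)
    qed
    ultimately show ?thesis by blast
  qed
  moreover have "block_on G (edge_orbit G e) {e}"
    using edge_orbit_self[OF G e\<Omega>] by (auto simp: block_on_def set_action_def)
  moreover have "\<not> graph_connected \<Omega> (edge_orbit G e - {e})"
    by (rule unsplit_graph_disconnected[OF part xy]) (use unsplit in auto)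
  ultimately show ?thesis
    using edge_orbit_in_edge_orbits[OF e(1)] finite_edge_orbit[OF fin G e\<Omega>]
    by (intro not_road_closure_if_block) auto
qed

section \<open>Cartesian powers\<close>

text \<open>
  An element of the wreath product carries the partition by coordinate \<open>\<sigma> i\<close> to the partition
  by coordinate \<open>i\<close>. Primitivity is what prevents the group from fixing a coordinate.
\<close>

proposition nonbasic_not_road_closure:
  assumes fin: "finite \<Omega>" and G: "subgroup G (BijGroup \<Omega>)"
    and "primitive_on G \<Omega>" "\<not> basic_on G \<Omega>"
  shows "\<not> road_closure_property G \<Omega>"
proof -
  have "preserves_cartesian_power G \<Omega>" using assms(3,4) by (simp add: basic_on_def)
  then obtain Q :: "nat set" and d f where Q: "card Q \<ge> 2" "d \<ge> 2"
    and f: "bij_betw f \<Omega> ({..<d} \<rightarrow>\<^sub>E Q)"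
    and w: "\<And>g. g \<in> G \<Longrightarrow> \<exists>w \<in> wreath_product_action Q d. \<forall>x\<in>\<Omega>. f (g x) = w (f x)"
    unfolding preserves_cartesian_power_def by blast
  define coord where "coord i = fibres \<Omega> (\<lambda>x. f x i)" for i
  have fQ: "f x \<in> {..<d} \<rightarrow>\<^sub>E Q" if "x \<in> \<Omega>" for x using f that by (auto simp: bij_betw_def)
  have permutes: "\<exists>\<sigma>\<in>Bij {..<d}. \<forall>i<d. (`) g ` coord (\<sigma> i) = coord i" if g: "g \<in> G" for g
  proof -
    obtain h \<sigma> where h: "\<And>i. i < d \<Longrightarrow> h i \<in> Bij Q" and \<sigma>: "\<sigma> \<in> Bij {..<d}"
      and act: "\<And>x. x \<in> \<Omega> \<Longrightarrow> f (g x) = (\<lambda>x \<in> ({..<d} \<rightarrow>\<^sub>E Q). \<lambda>i\<in>{..<d}. h i (x (\<sigma> i))) (f x)"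
      using w[OF g] unfolding wreath_product_action_def by blast
    have \<sigma>d: "\<sigma> i < d" if "i < d" for i using \<sigma> that by (auto simp: Bij_def bij_betw_def)
    have "(`) g ` coord (\<sigma> i) = coord i" if i: "i < d" for i
      unfolding coord_def
    proof (rule image_fibres[OF perm_group_bij[OF G g]])
      fix x y assume xy: "x \<in> \<Omega>" "y \<in> \<Omega>"
      have "f z (\<sigma> i) \<in> Q" "f (g z) i = h i (f z (\<sigma> i))" if "z \<in> \<Omega>" for z
        using fQ[OF that] \<sigma>d[OF i] act[OF that] i by auto
      moreover have "inj_on (h i) Q" using h[OF i] by (auto simp: Bij_def bij_betw_def)
      ultimately show "f (g x) i = f (g y) i \<longleftrightarrow> f x (\<sigma> i) = f y (\<sigma> i)"
        using xy by (auto dest: inj_onD)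
    qed
    then show ?thesis using \<sigma> by blast
  qed
  obtain a b where ab: "a \<in> Q" "b \<in> Q" "a \<noteq> b"
    using Q(1) by (metis card_2_iff' obtain_subset_with_card_n subsetD)
  have tuple: "\<exists>x\<in>\<Omega>. f x = t" if "t \<in> {..<d} \<rightarrow>\<^sub>E Q" for t
    using that bij_betw_imp_surj_on[OF f] by (metis imageE)
  obtain x where x: "x \<in> \<Omega>" "f x = (\<lambda>i\<in>{..<d}. a)" using tuple[of "\<lambda>i\<in>{..<d}. a"] ab by auto
  obtain y where y: "y \<in> \<Omega>" "f y = (\<lambda>i\<in>{..<d}. if i = 0 then b else a)"
    using tuple[of "\<lambda>i\<in>{..<d}. if i = 0 then b else a"] ab by auto
  \<comment> \<open>The tuple z shows that a coordinate partition has a part with more than one element; this is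
    where at least two coordinates are needed.\<close>
  obtain z where z: "z \<in> \<Omega>" "f z = (\<lambda>i\<in>{..<d}. if i = 1 then b else a)"
    using tuple[of "\<lambda>i\<in>{..<d}. if i = 1 then b else a"] ab by auto
  have split_xy: "splits (coord i) {x, y} \<longleftrightarrow> i = 0" if "i < d" for i
    unfolding coord_def splits_fibres[OF x(1) y(1)] using x(2) y(2) ab that by auto
  have "x \<noteq> y" using x y ab Q(2) by (auto dest!: fun_cong[of _ _ 0])
  have "x \<noteq> z" using x z ab Q(2) by (auto dest!: fun_cong[of _ _ 1])
  have "nontrivial_partition \<Omega> (coord 0)"
  proof -
    have "\<not> splits (coord 0) {x, z}"
      unfolding coord_def splits_fibres[OF x(1) z(1)] using x(2) z(2) Q(2) by simp
    then have "coord 0 \<noteq> (\<lambda>x. {x}) ` \<Omega>" using \<open>x \<noteq> z\<close> by (auto simp: splits_def)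
    moreover have "coord 0 \<noteq> {\<Omega>}" using split_xy[of 0] Q(2) x(1) y(1) by (auto simp: splits_def)
    ultimately show ?thesis
      by (simp add: nontrivial_partition_def coord_def partition_on_fibres)
  qed
  then obtain g0 where g0: "g0 \<in> G" "(`) g0 ` coord 0 \<noteq> coord 0"
    using assms(3) unfolding primitive_on_def preserves_partition_def by blast
  show ?thesis
  proof (rule not_road_closure_if_split_once[OF fin G, where \<P> = "coord ` {..<d}"])
    show "partition_on \<Omega> P" if "P \<in> coord ` {..<d}" for P
      using that by (auto simp: coord_def partition_on_fibres)
    show "(`) g ` P \<in> coord ` {..<d}" if g: "g \<in> G" and P: "P \<in> coord ` {..<d}" for g P
    proof -
      obtain \<sigma> where \<sigma>: "\<sigma> \<in> Bij {..<d}" "\<forall>i<d. (`) g ` coord (\<sigma> i) = coord i"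
        using permutes[OF g] by blast
      obtain j where "j < d" "P = coord j" using P by auto
      moreover have "\<sigma> ` {..<d} = {..<d}" using \<sigma>(1) by (simp add: Bij_def bij_betw_def)
      ultimately obtain i where "i < d" "j = \<sigma> i" by (metis imageE lessThan_iff)
      then show ?thesis using \<sigma>(2) \<open>P = coord j\<close> by auto
    qed
    show "{x, y} \<in> two_subsets \<Omega>" using x(1) y(1) \<open>x \<noteq> y\<close> by (auto simp: two_subsets_def)
    show "coord 0 \<in> coord ` {..<d}" using Q(2) by auto
    show "splits (coord 0) {x, y}" using split_xy[of 0] Q(2) by simp
    show "P' = coord 0" if "P' \<in> coord ` {..<d}" "splits P' {x, y}" for P'
      using that split_xy by auto
  qed (rule g0)+
qed

section \<open>Imprimitive normal subgroups of index two\<close>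

text \<open>
  Having the same part in every member of an invariant family is an invariant equivalence
  relation. It is not universal, because \<open>P\<close> splits some pair, so by primitivity it is equality.
\<close>

lemma primitive_family_splits:
  assumes fin: "finite \<Omega>" and G: "subgroup G (BijGroup \<Omega>)" and prim: "primitive_on G \<Omega>"
    and parts: "\<And>P. P \<in> \<P> \<Longrightarrow> partition_on \<Omega> P"
    and invariant: "\<And>g P. g \<in> G \<Longrightarrow> P \<in> \<P> \<Longrightarrow> (`) g ` P \<in> \<P>"
    and P: "P \<in> \<P>" "nontrivial_partition \<Omega> P"
    and e: "e \<in> two_subsets \<Omega>"
  shows "\<exists>P'\<in>\<P>. splits P' e"
proof -
  \<comment> \<open>The fibres of F are the parts of the common refinement of the family.\<close>
  define F where "F x = {C \<in> \<Union>\<P>. x \<in> C}" for x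
  have F_iff: "F x = F y \<longleftrightarrow> (\<forall>P'\<in>\<P>. \<not> splits P' {x, y})" if xy: "x \<in> \<Omega>" "y \<in> \<Omega>" for x y
  proof (intro iffI ballI)
    fix P' assume "F x = F y" and P': "P' \<in> \<P>"
    obtain C where "C \<in> P'" "x \<in> C" using xy partition_onD1[OF parts[OF P']] by auto
    then have "C \<in> F x" using P' by (auto simp: F_def)
    then have "C \<in> F y" using \<open>F x = F y\<close> by simp
    then have "y \<in> C" by (simp add: F_def)
    then show "\<not> splits P' {x, y}" using \<open>C \<in> P'\<close> \<open>x \<in> C\<close> by (auto simp: splits_def)
  next
    assume unsplit: "\<forall>P'\<in>\<P>. \<not> splits P' {x, y}"
    have "x \<in> C \<longleftrightarrow> y \<in> C" if C: "C \<in> P'" and P': "P' \<in> \<P>" for C P'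
    proof -
      obtain D where "D \<in> P'" "{x, y} \<subseteq> D" using unsplit P' by (auto simp: splits_def)
      then show ?thesis using partition_onD2[OF parts[OF P']] C by (auto dest: disjointD)
    qed
    then show "F x = F y" by (auto simp: F_def)
  qed
  have "(`) g ` fibres \<Omega> F = fibres \<Omega> F" if g: "g \<in> G" for g
  proof (rule image_fibres[OF perm_group_bij[OF G g]])
    fix x y assume xy: "x \<in> \<Omega>" "y \<in> \<Omega>"
    have gxy: "g x \<in> \<Omega>" "g y \<in> \<Omega>" using perm_group_image_subset[OF G g] xy by auto
    have sub: "\<P> \<subseteq> Pow (Pow \<Omega>)" using parts partition_onD1 by blast
    have inj: "inj_on ((`) ((`) g)) \<P>"
      by (rule inj_on_subset[OF inj_on_image_Pow[OF inj_on_image_Pow] sub])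
        (use perm_group_bij[OF G g] in \<open>simp add: bij_betw_def\<close>)
    have "finite \<P>" by (rule finite_subset[OF sub]) (use fin in simp)
    then have image_\<P>: "(`) ((`) g) ` \<P> = \<P>"
      using inj invariant[OF g] by (intro endo_inj_surj) auto
    have "(\<forall>P'\<in>\<P>. \<not> splits P' {g x, g y}) \<longleftrightarrow> (\<forall>P'\<in>(`) ((`) g) ` \<P>. \<not> splits P' (g ` {x, y}))"
      unfolding image_\<P> by simp
    also have "\<dots> \<longleftrightarrow> (\<forall>P'\<in>\<P>. \<not> splits ((`) g ` P') (g ` {x, y}))" by blast
    also have "\<dots> \<longleftrightarrow> (\<forall>P'\<in>\<P>. \<not> splits P' {x, y})"
      using splits_image[OF G g parts, of _ "{x, y}"] xy by (simp del: image_insert)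
    finally show "F (g x) = F (g y) \<longleftrightarrow> F x = F y"
      unfolding F_iff[OF xy] F_iff[OF gxy] .
  qed
  then have "preserves_partition G (fibres \<Omega> F)" by (auto simp: preserves_partition_def)
  then have "\<not> nontrivial_partition \<Omega> (fibres \<Omega> F)" using prim by (auto simp: primitive_on_def)
  moreover have "fibres \<Omega> F \<noteq> {\<Omega>}"
  proof
    assume "fibres \<Omega> F = {\<Omega>}"
    moreover obtain x y where "x \<in> \<Omega>" "y \<in> \<Omega>" "splits P {x, y}"
      using nontrivial_partition_split[OF P(2)] .
    ultimately show False
      using F_iff[of x y] P(1) splits_fibres[of x \<Omega> y F] by (auto simp: splits_def[of "{\<Omega>}"])
  qed
  ultimately have single: "fibres \<Omega> F = (\<lambda>x. {x}) ` \<Omega>"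
    by (auto simp: nontrivial_partition_def partition_on_fibres)
  obtain x y where xy: "e = {x, y}" "x \<in> \<Omega>" "y \<in> \<Omega>" "x \<noteq> y" using e by (rule two_subsetsE)
  then have "splits (fibres \<Omega> F) {x, y}" unfolding single by (auto simp: splits_def)
  then show ?thesis using F_iff[of x y] splits_fibres[of x \<Omega> y F] xy by auto
qed

lemma index_two_coset:
  assumes "group H" "subgroup N H" "card (rcosets\<^bsub>H\<^esub> N) = 2"
    and g: "g \<in> carrier H - N" and h: "h \<in> carrier H - N"
  shows "\<exists>n\<in>N. h = n \<otimes>\<^bsub>H\<^esub> g"
proof -
  interpret group H by fact
  have N: "N \<in> rcosets\<^bsub>H\<^esub> N"
    using subgroup.subgroup_in_rcosets[OF assms(2) is_group] .
  have mem: "N #>\<^bsub>H\<^esub> a \<in> rcosets\<^bsub>H\<^esub> N" "a \<in> N #>\<^bsub>H\<^esub> a" if "a \<in> carrier H" for a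
    using that rcosetsI[OF subgroup.subset[OF assms(2)]] rcos_self[OF that assms(2)] by auto
  have "N #>\<^bsub>H\<^esub> g \<noteq> N" "N #>\<^bsub>H\<^esub> h \<noteq> N" using mem g h by blast+
  then have "N #>\<^bsub>H\<^esub> g = N #>\<^bsub>H\<^esub> h"
    using assms(3) N mem(1)[of g] mem(1)[of h] g h by (auto simp: card_2_iff)
  then have "h \<in> N #>\<^bsub>H\<^esub> g" using mem(2)[of h] h by auto
  then show ?thesis by (auto simp: r_coset_def)
qed

text \<open>
  The images of \<open>P\<close> under \<open>G\<close> are \<open>P\<close> and one further partition, as the stabilizer of \<open>P\<close>
  contains \<open>N\<close>. An edge inside a part of the second one must be split by \<open>P\<close>.
\<close>

proposition index_two_not_road_closure:
  assumes fin: "finite \<Omega>" and G: "subgroup G (BijGroup \<Omega>)" and prim: "primitive_on G \<Omega>"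
    and N: "N \<lhd> perm_group G \<Omega>" "card (rcosets\<^bsub>perm_group G \<Omega>\<^esub> N) = 2" "imprimitive_on N \<Omega>"
  shows "\<not> road_closure_property G \<Omega>"
proof -
  let ?H = "perm_group G \<Omega>"
  have H: "group ?H" using subgroup.subgroup_is_group[OF G group_BijGroup] .
  have NH: "subgroup N ?H" using N(1) by (simp add: normal_def)
  have "N \<subseteq> G" using subgroup.subset[OF NH] by simp
  have NB: "subgroup N (BijGroup \<Omega>)" using group.incl_subgroup[OF group_BijGroup G NH] .
  have mult: "a \<otimes>\<^bsub>?H\<^esub> b = compose \<Omega> a b" if "a \<in> G" "b \<in> G" for a b
    using that subgroup.subset[OF G] by (auto simp: BijGroup_def subset_iff)
  obtain P where P: "nontrivial_partition \<Omega> P" "preserves_partition N P"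
    using N(3) by (auto simp: imprimitive_on_def primitive_on_def)
  have part: "partition_on \<Omega> P" using P(1) by (simp add: nontrivial_partition_def)
  then have P\<Omega>: "\<And>C. C \<in> P \<Longrightarrow> C \<subseteq> \<Omega>" using partition_onD1 by blast
  have NP: "(`) n ` P = P" if "n \<in> N" for n
    using preserves_partition_image[OF fin NB part P(2) that] .
  have "\<not> preserves_partition G P" using prim P(1) by (auto simp: primitive_on_def)
  then obtain g where g: "g \<in> G" "(`) g ` P \<noteq> P" unfolding preserves_partition_def by blast
  have conj: "(`) (compose \<Omega> a b) ` P = (`) a ` (`) b ` P" for a b
    by (rule image_compose_on_family) (rule P\<Omega>)
  have orbit: "(`) h ` P = P \<or> (`) h ` P = (`) g ` P" if h: "h \<in> G" for h
  proof (cases "h \<in> N")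
    case False
    moreover have "g \<notin> N" using g NP by blast
    ultimately obtain n where n: "n \<in> N" "h = n \<otimes>\<^bsub>?H\<^esub> g"
      using index_two_coset[OF H NH N(2), of g h] g(1) h by auto
    \<comment> \<open>Normality moves the factor from N to the right of g, where it fixes P.\<close>
    have "n \<otimes>\<^bsub>?H\<^esub> g \<in> g <#\<^bsub>?H\<^esub> N"
      using normal.coset_eq[OF N(1)] g(1) n(1) by (auto simp: r_coset_def)
    then obtain n' where n': "n' \<in> N" "h = g \<otimes>\<^bsub>?H\<^esub> n'" using n(2) by (auto simp: l_coset_def)
    then have "h = compose \<Omega> g n'" using mult[of g n'] g(1) \<open>N \<subseteq> G\<close> by auto
    then show ?thesis using conj[of g n'] NP[OF n'(1)] by simp
  qed (use NP in auto)
  obtain c where c: "c \<in> two_subsets \<Omega>" "\<not> splits P c" using nontrivial_partition_edge[OF P(1)] .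
  have c\<Omega>: "c \<subseteq> \<Omega>" using c by (simp add: two_subsets_def)
  define \<P> where "\<P> = (\<lambda>h. (`) h ` P) ` G"
  have parts: "partition_on \<Omega> P'" if P': "P' \<in> \<P>" for P'
  proof -
    obtain h where h: "h \<in> G" "P' = (`) h ` P" using P' by (auto simp: \<P>_def)
    have "{} \<notin> P'" using h(2) partition_onD3[OF part] by auto
    then show ?thesis
      using partition_on_inj_image[OF part, of h] perm_group_bij[OF G h(1)] h(2)
      by (simp add: bij_betw_def)
  qed
  have invariant: "(`) h ` P' \<in> \<P>" if h: "h \<in> G" and P': "P' \<in> \<P>" for h P'
  proof -
    obtain k where "k \<in> G" "P' = (`) k ` P" using P' by (auto simp: \<P>_def)
    then show ?thesis using conj[of h k] perm_group_compose[OF G h] unfolding \<P>_def by (metis imageI)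
  qed
  have P_mem: "P \<in> \<P>"
    using NP[OF perm_group_id[OF NB]] perm_group_id[OF G] unfolding \<P>_def by (metis imageI)
  have gc: "g ` c \<in> two_subsets \<Omega>" by (rule perm_group_two_subsets[OF G g(1) c(1)])
  have g_unsplit: "\<not> splits ((`) g ` P) (g ` c)" using splits_image[OF G g(1) part c\<Omega>] c(2) by simp
  have two: "P' = P \<or> P' = (`) g ` P" if "P' \<in> \<P>" for P'
    using that orbit unfolding \<P>_def by (elim imageE) simp
  obtain P1 where "P1 \<in> \<P>" "splits P1 (g ` c)"
    using primitive_family_splits[OF fin G prim parts invariant P_mem P(1) gc] by blast
  then have P_split: "splits P (g ` c)" using two g_unsplit by blast
  show ?thesis
  proof (rule not_road_closure_if_split_once[OF fin G parts invariant gc P_mem P_split _ g])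
    show "P' = P" if "P' \<in> \<P>" "splits P' (g ` c)" for P'
      using that two g_unsplit by blast
  qed
qed

section \<open>Annihilators\<close>

text \<open>
  Over a finite field the scalar product has isotropic vectors, so a subspace and its annihilator need not
  be complements. The bound holds because each further independent vector \<open>b\<close> cuts the annihilator down: some linear
  functional is 1 at \<open>b\<close> and vanishes on the previous vectors.
\<close>

lemma dim_annihilator_le:
  fixes B :: "('k::field ^ 'n) set"
  assumes "vec.independent B"
  shows "vec.dim {v. \<forall>b\<in>B. (\<Sum>i\<in>UNIV. b $ i * v $ i) = 0} + card B \<le> CARD('n)"
proof -
  have "finite B" using assms by (rule vec.finiteI_independent)
  then show ?thesis using assms
  proof (induction B rule: finite_induct)
    case empty
    show ?case using dim_subset_UNIV_cart_gen[of "UNIV :: ('k ^ 'n) set"] by simp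
  next
    case (insert b B)
    let ?ann = "\<lambda>B :: ('k ^ 'n) set. {v. \<forall>b\<in>B. (\<Sum>i\<in>UNIV. b $ i * v $ i) = 0}"
    have sub: "vec.subspace (?ann A)" for A
      by (auto simp: vec.subspace_def algebra_simps sum.distrib simp flip: sum_distrib_left)
    obtain f :: "'k ^ 'n \<Rightarrow> 'k ^ 'n" where f: "Vector_Spaces.linear (*s) (*s) f"
      and fB: "\<And>x. x \<in> insert b B \<Longrightarrow> f x = (if x = b then 1 else 0)"
      using vec.linear_independent_extend[OF insert.prems, of "\<lambda>x. if x = b then 1 else 0"] by blast
    \<comment> \<open>Each coordinate of f is such a functional, hence the scalar product with a row w of its matrix.\<close>
    define j :: 'n where "j = undefined"
    define w where "w = (\<chi> i. matrix f $ j $ i)"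
    have w: "(\<Sum>i\<in>UNIV. x $ i * w $ i) = f x $ j" for x
    proof -
      have "f x $ j = (matrix f *v x) $ j" using matrix_works[OF f] by simp
      then show ?thesis by (simp add: matrix_vector_mult_def w_def mult.commute)
    qed
    have "w \<in> ?ann B" using w fB insert.hyps(2) by fastforce
    moreover have "w \<notin> ?ann (insert b B)" using w[of b] fB[of b] by simp
    ultimately have "?ann (insert b B) \<subset> ?ann B" by blast
    then have "vec.dim (?ann (insert b B)) < vec.dim (?ann B)"
      by (intro vec.dim_psubset) (simp only: vec.span_eq_iff[THEN iffD2, OF sub])
    moreover have "vec.dim (?ann B) + card B \<le> CARD('n)"
      using insert.IH insert.prems vec.independent_insert by (metis insert.hyps(2))
    ultimately show ?case using insert.hyps by simp
  qed
qed

section \<open>The hyperbolic quadric\<close>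

lemma exhaust_8: "(i :: 8) \<in> {0, 1, 2, 3, 4, 5, 6, 7}"
proof (induct i)
  case (of_int z)
  then have "z \<in> {0, 1, 2, 3, 4, 5, 6, 7}" by auto
  then show ?case by auto
qed

lemma UNIV_8: "(UNIV :: 8 set) = {0, 1, 2, 3, 4, 5, 6, 7}"
  using exhaust_8 by auto

lemma forall_8: "(\<forall>i :: 8. P i) \<longleftrightarrow> P 0 \<and> P 1 \<and> P 2 \<and> P 3 \<and> P 4 \<and> P 5 \<and> P 6 \<and> P 7"
  using exhaust_8 by (metis insertE emptyE)

lemma sum_8: "(\<Sum>i\<in>UNIV. f (i :: 8)) = f 0 + f 1 + f 2 + f 3 + f 4 + f 5 + f 6 + f 7"
  unfolding UNIV_8 by (simp add: ac_simps)

text \<open>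
  The bilinear form that polarizes \<open>hyperbolic_form\<close>.
\<close>

definition polar_form :: "'k::field ^ 8 \<Rightarrow> 'k ^ 8 \<Rightarrow> 'k" where
  "polar_form u v = u$0 * v$1 + u$1 * v$0 + u$2 * v$3 + u$3 * v$2
     + u$4 * v$5 + u$5 * v$4 + u$6 * v$7 + u$7 * v$6"

lemma hyperbolic_form_add:
  "hyperbolic_form (u + v) = hyperbolic_form u + hyperbolic_form v + polar_form u v"
  by (simp add: hyperbolic_form_def polar_form_def algebra_simps)

lemma polar_form_add_right: "polar_form u (v + w) = polar_form u v + polar_form u w"
  by (simp add: polar_form_def algebra_simps)

lemma totally_singular_polar_form:
  assumes "totally_singular S" "u \<in> S" "v \<in> S"
  shows "polar_form u v = 0"
proof -
  have "u + v \<in> S" using assms by (simp add: totally_singular_def vec.subspace_add)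
  then show ?thesis using hyperbolic_form_add[of u v] assms by (simp add: totally_singular_def)
qed

text \<open>
  The polar form is nondegenerate, so orthogonal subspaces have dimensions that add up to at
  most 8.
\<close>

lemma dim_perp_le:
  fixes U X :: "('k::{field,finite} ^ 8) set"
  assumes "\<And>u x. u \<in> U \<Longrightarrow> x \<in> X \<Longrightarrow> polar_form u x = 0"
  shows "vec.dim X + vec.dim U \<le> 8"
proof -
  obtain B where B: "B \<subseteq> U" "vec.independent B" "card B = vec.dim U"
    using vec.basis_exists by metis
  \<comment> \<open>Swapping the coordinates of each hyperbolic pair turns the polar form into the scalar product.\<close>
  define swap :: "'k ^ 8 \<Rightarrow> 'k ^ 8" where
    "swap v = (\<chi> i. if i = 0 then v$1 else if i = 1 then v$0 else if i = 2 then v$3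
       else if i = 3 then v$2 else if i = 4 then v$5 else if i = 5 then v$4
       else if i = 6 then v$7 else v$6)" for v
  have "Vector_Spaces.linear (*s) (*s) swap"
    by unfold_locales (auto simp: swap_def vec_eq_iff algebra_simps)
  moreover have "inj_on swap (vec.span X)"
    by (rule inj_onI) (auto simp: swap_def vec_eq_iff forall_8)
  ultimately have "vec.dim X = vec.dim (swap ` X)" by (simp add: vec.dim_image_eq)
  also have "\<dots> \<le> vec.dim {v. \<forall>b\<in>B. (\<Sum>i\<in>UNIV. b $ i * v $ i) = 0}"
  proof (rule vec.dim_subset, rule subsetI)
    fix y assume "y \<in> swap ` X"
    then obtain x where x: "x \<in> X" "y = swap x" by auto
    have "(\<Sum>i\<in>UNIV. b $ i * y $ i) = polar_form b x" for b
      by (simp add: sum_8 x(2) swap_def polar_form_def)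
    then show "y \<in> {v. \<forall>b\<in>B. (\<Sum>i\<in>UNIV. b $ i * v $ i) = 0}" using assms x(1) B(1) by auto
  qed
  finally show ?thesis using dim_annihilator_le[OF B(2)] B(3) by simp
qed

subsection \<open>Two solids that meet in a plane\<close>

definition coordinate_subspace :: "8 set \<Rightarrow> ('k::field ^ 8) set" where
  "coordinate_subspace I = {v. \<forall>i. i \<notin> I \<longrightarrow> v $ i = 0}"

lemma subspace_coordinate_subspace: "vec.subspace (coordinate_subspace I)"
  by (auto simp: coordinate_subspace_def vec.subspace_def)

lemma dim_coordinate_subspace: "vec.dim (coordinate_subspace I :: ('k::field ^ 8) set) = card I"
  unfolding coordinate_subspace_def by (rule dim_substandard_cart)

lemma coordinate_subspace_Int:
  "coordinate_subspace I \<inter> coordinate_subspace J = coordinate_subspace (I \<inter> J)"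
  by (auto simp: coordinate_subspace_def)

lemma coordinate_subspace_mono: "I \<subseteq> J \<Longrightarrow> coordinate_subspace I \<subseteq> coordinate_subspace J"
  by (auto simp: coordinate_subspace_def)

text \<open>
  Both solids contain the plane spanned by the basis vectors 0, 2 and 4; they are the only solids
  that contain it, which is why every other solid can be compared with just these two.
\<close>

abbreviation solid6 :: "('k::field ^ 8) set" where "solid6 \<equiv> coordinate_subspace {0, 2, 4, 6}"
abbreviation solid7 :: "('k::field ^ 8) set" where "solid7 \<equiv> coordinate_subspace {0, 2, 4, 7}"

lemma coordinate_solids:
  "(solid6 :: ('k::{field,finite} ^ 8) set) \<in> solids"
  "(solid7 :: ('k::{field,finite} ^ 8) set) \<in> solids"
proof -
  have "hyperbolic_form v = 0" if "v \<in> solid6 \<or> v \<in> solid7" for v :: "'k ^ 8"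
    using that by (auto simp: coordinate_subspace_def hyperbolic_form_def)
  then show "(solid6 :: ('k ^ 8) set) \<in> solids" "(solid7 :: ('k ^ 8) set) \<in> solids"
    by (auto simp: solids_def totally_singular_def subspace_coordinate_subspace dim_coordinate_subspace)
qed

lemma coordinate_points:
  "(coordinate_subspace {0} :: ('k::{field,finite} ^ 8) set) \<in> polar_points"
  "(coordinate_subspace {2} :: ('k::{field,finite} ^ 8) set) \<in> polar_points"
proof -
  have "hyperbolic_form v = 0" if "v \<in> coordinate_subspace {0} \<or> v \<in> coordinate_subspace {2}"
    for v :: "'k ^ 8"
    using that by (auto simp: coordinate_subspace_def hyperbolic_form_def)
  then show "(coordinate_subspace {0} :: ('k ^ 8) set) \<in> polar_points"
    "(coordinate_subspace {2} :: ('k ^ 8) set) \<in> polar_points"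
    by (auto simp: polar_points_def totally_singular_def subspace_coordinate_subspace
        dim_coordinate_subspace)
qed

lemma dim_hyperplane_section:
  fixes S :: "('k::field ^ 8) set"
  assumes "vec.subspace S" and U: "U = {v\<in>S. v $ i = 0}" and u: "u \<in> S" "u $ i \<noteq> 0"
  shows "vec.dim S = vec.dim U + 1"
proof -
  have U_sub: "vec.subspace U" using assms(1) by (auto simp: U vec.subspace_def)
  have "S \<subseteq> vec.span (insert u U)"
  proof
    fix v assume v: "v \<in> S"
    let ?c = "v $ i / u $ i"
    have "v - ?c *s u \<in> U"
      using v u assms(1) by (auto simp: U vec.subspace_diff vec.subspace_scale)
    then show "v \<in> vec.span (insert u U)" unfolding vec.span_insert
      using vec.span_base by blast
  qed
  moreover have "insert u U \<subseteq> S" using u by (auto simp: U)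
  ultimately have "vec.dim S = vec.dim (insert u U)"
    by (meson antisym vec.dim_mono vec.dim_subset)
  moreover have "u \<notin> vec.span U" using u U_sub by (simp add: U vec.span_eq_iff[THEN iffD2])
  ultimately show ?thesis by (simp add: vec.dim_insert)
qed

text \<open>
  Let \<open>W\<close> be the common plane of the two solids and \<open>U = S \<inter> W\<close>. Each of them meets \<open>S\<close>
  in \<open>U\<close> or in one dimension more.

  They cannot both do the latter, since two vectors outside \<open>W\<close> from different coordinate solids
  are not orthogonal. If neither did, then \<open>S\<close> would meet the orthogonal space \<open>N\<close> of \<open>W\<close>,
  of dimension 5, only in \<open>U\<close>: the singular vectors of \<open>N\<close> lie in the two solids. But then
  \<open>S + N\<close> would have dimension \<open>9 - dim U\<close>, which is too large for a subspace orthogonal to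
  \<open>U\<close>.
\<close>

lemma solid_meets_one_more:
  fixes S :: "('k::{field,finite} ^ 8) set"
  assumes "S \<in> solids"
  shows "even (vec.dim (S \<inter> solid6)) \<noteq> even (vec.dim (S \<inter> solid7))"
proof -
  have S: "totally_singular S" "vec.subspace S" "vec.dim S = 4"
    using assms by (auto simp: solids_def totally_singular_def)
  define U where "U = S \<inter> coordinate_subspace {0, 2, 4}"
  let ?N = "coordinate_subspace {0, 2, 4, 6, 7} :: ('k ^ 8) set"
  have dim_meet: "vec.dim (S \<inter> coordinate_subspace I) =
      (if S \<inter> coordinate_subspace I \<subseteq> U then vec.dim U else vec.dim U + 1)"
    if I: "I = insert i {0, 2, 4}" and i: "i \<notin> {0, 2, 4}" for I i
  proof -
    let ?SI = "S \<inter> coordinate_subspace I"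
    have U_eq: "U = {v \<in> ?SI. v $ i = 0}"
      using i by (auto simp: U_def I coordinate_subspace_def)
    show ?thesis
    proof (cases "?SI \<subseteq> U")
      case True
      then have "?SI = U" using U_eq by blast
      then show ?thesis by simp
    next
      case False
      then obtain u where "u \<in> ?SI" "u $ i \<noteq> 0" using U_eq by blast
      moreover have "vec.subspace ?SI"
        using S(2) subspace_coordinate_subspace by (rule vec.subspace_inter)
      ultimately have "vec.dim ?SI = vec.dim U + 1"
        using U_eq by (intro dim_hyperplane_section)
      then show ?thesis using False by simp
    qed
  qed
  have dim_solid6: "vec.dim (S \<inter> solid6) = (if S \<inter> solid6 \<subseteq> U then vec.dim U else vec.dim U + 1)"
    by (rule dim_meet[of _ 6]) auto
  have dim_solid7: "vec.dim (S \<inter> solid7) = (if S \<inter> solid7 \<subseteq> U then vec.dim U else vec.dim U + 1)"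
    by (rule dim_meet[of _ 7]) auto
  have "\<not> (S \<inter> solid6 \<subseteq> U \<and> S \<inter> solid7 \<subseteq> U)"
  proof
    assume small: "S \<inter> solid6 \<subseteq> U \<and> S \<inter> solid7 \<subseteq> U"
    have "S \<inter> ?N \<subseteq> U"
    proof
      fix v assume v: "v \<in> S \<inter> ?N"
      then have zero: "v $ 1 = 0" "v $ 3 = 0" "v $ 5 = 0" by (auto simp: coordinate_subspace_def)
      have "hyperbolic_form v = 0" using v S(1) by (simp add: totally_singular_def)
      then have "v $ 6 = 0 \<or> v $ 7 = 0" using zero by (simp add: hyperbolic_form_def)
      then have "v \<in> solid6 \<or> v \<in> solid7"
        using zero by (auto simp: coordinate_subspace_def forall_8)
      then show "v \<in> U" using v small by blast
    qed
    moreover have "U \<subseteq> S \<inter> ?N"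
      unfolding U_def by (intro Int_mono coordinate_subspace_mono) auto
    ultimately have "S \<inter> ?N = U" by blast
    then have "vec.dim {x + y | x y. x \<in> S \<and> y \<in> ?N} + vec.dim U = 9"
      using vec.dim_sums_Int[OF S(2) subspace_coordinate_subspace[of "{0, 2, 4, 6, 7}"]] S(3)
      by (simp add: dim_coordinate_subspace)
    moreover have "polar_form u z = 0"
      if u: "u \<in> U" and z: "z \<in> {x + y | x y. x \<in> S \<and> y \<in> ?N}" for u z
    proof -
      obtain x y where xy: "z = x + y" "x \<in> S" "y \<in> ?N" using z by auto
      have "polar_form u x = 0"
        using u xy(2) by (intro totally_singular_polar_form[OF S(1)]) (auto simp: U_def)
      moreover have "polar_form u y = 0"
        using u xy(3) by (auto simp: U_def coordinate_subspace_def polar_form_def)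
      ultimately show ?thesis by (simp add: xy(1) polar_form_add_right)
    qed
    then have "vec.dim {x + y | x y. x \<in> S \<and> y \<in> ?N} + vec.dim U \<le> 8" by (rule dim_perp_le)
    ultimately show False by simp
  qed
  moreover have "S \<inter> solid6 \<subseteq> U \<or> S \<inter> solid7 \<subseteq> U"
  proof (rule ccontr)
    assume "\<not> ?thesis"
    then obtain u v where u: "u \<in> S" "u \<in> solid6" "u \<notin> U" and v: "v \<in> S" "v \<in> solid7" "v \<notin> U"
      by blast
    have "u $ 6 \<noteq> 0" "v $ 7 \<noteq> 0"
      using u v by (auto simp: U_def coordinate_subspace_def forall_8)
    moreover have "polar_form u v = u $ 6 * v $ 7"
      using u(2) v(2) by (simp add: coordinate_subspace_def polar_form_def)
    ultimately show False using totally_singular_polar_form[OF S(1) u(1) v(1)] by simp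
  qed
  ultimately show ?thesis unfolding dim_solid6 dim_solid7 by auto
qed

section \<open>Induced actions\<close>

lemma perm_group_preserved_image:
  assumes H: "subgroup H (BijGroup X)" and \<X>: "\<And>U. U \<in> \<X> \<Longrightarrow> U \<subseteq> X"
    and closed: "\<And>h U. h \<in> H \<Longrightarrow> U \<in> \<X> \<Longrightarrow> h ` U \<in> \<X>" and h: "h \<in> H"
  shows "set_action \<X> h \<in> Bij \<X>"
proof -
  define k where "k = (\<lambda>x\<in>X. inv_into X h x)"
  have k: "k \<in> H" unfolding k_def by (rule perm_group_inverse[OF H h])
  have bij: "bij_betw h X X" by (rule perm_group_bij[OF H h])
  have "inj_on ((`) h) \<X>"
    by (rule inj_on_subset[OF inj_on_image_Pow]) (use bij \<X> in \<open>auto simp: bij_betw_def\<close>)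
  then have inj: "inj_on (set_action \<X> h) \<X>" by (simp add: set_action_def inj_on_def)
  have "U \<in> set_action \<X> h ` \<X>" if U: "U \<in> \<X>" for U
  proof -
    have "h (k x) = x" if "x \<in> U" for x
      using that \<X>[OF U] bij by (auto simp: k_def bij_betw_def f_inv_into_f)
    then have "h ` k ` U = U" by (simp add: image_image)
    then have "U = set_action \<X> h (k ` U)"
      using closed[OF k U] by (simp add: set_action_def)
    then show ?thesis using closed[OF k U] by blast
  qed
  moreover have "set_action \<X> h ` \<X> \<subseteq> \<X>" using closed[OF h] by (auto simp: set_action_def)
  ultimately show ?thesis using inj by (auto simp: Bij_def bij_betw_def set_action_def)
qed

text \<open>
  Both permutation representations in the construction of the triality group, from vectors to
  objects and from objects to triples, are of this kind.
\<close>

lemma set_action_subgroup: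
  assumes H: "subgroup H (BijGroup X)" and \<X>: "\<And>U. U \<in> \<X> \<Longrightarrow> U \<subseteq> X"
    and closed: "\<And>h U. h \<in> H \<Longrightarrow> U \<in> \<X> \<Longrightarrow> h ` U \<in> \<X>"
  shows "subgroup (set_action \<X> ` H) (BijGroup \<X>)"
proof -
  have bij: "set_action \<X> h \<in> Bij \<X>" if "h \<in> H" for h
    by (rule perm_group_preserved_image[OF H \<X> closed that])
  have "set_action \<X> (g \<otimes>\<^bsub>BijGroup X\<^esub> h) = set_action \<X> g \<otimes>\<^bsub>BijGroup \<X>\<^esub> set_action \<X> h"
    if g: "g \<in> H" and h: "h \<in> H" for g h
  proof -
    have "g \<otimes>\<^bsub>BijGroup X\<^esub> h = compose X g h"
      using g h subgroup.subset[OF H] by (auto simp: BijGroup_def)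
    moreover have "set_action \<X> g \<otimes>\<^bsub>BijGroup \<X>\<^esub> set_action \<X> h
        = compose \<X> (set_action \<X> g) (set_action \<X> h)"
      using bij g h by (simp add: BijGroup_def)
    moreover have "set_action \<X> (compose X g h) U = compose \<X> (set_action \<X> g) (set_action \<X> h) U" for U
    proof (cases "U \<in> \<X>")
      case True
      then show ?thesis
        using closed[OF h True] image_compose_on[OF \<X>[OF True], of g h]
        by (simp add: set_action_def compose_eq)
    qed (simp add: set_action_def compose_def)
    ultimately show ?thesis by auto
  qed
  then have "set_action \<X> \<in> hom (perm_group H X) (BijGroup \<X>)"
    using bij by (auto simp: hom_def BijGroup_def)
  then have "group_hom (perm_group H X) (BijGroup \<X>) (set_action \<X>)"
    using subgroup.subgroup_is_group[OF H group_BijGroup] group_BijGroup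
    by (simp add: group_hom_def group_hom_axioms_def)
  from group_hom.img_is_subgroup[OF this] show ?thesis by simp
qed

section \<open>Correlations\<close>

text \<open>
  The triples are defined through incidence and the three types, so these are the permutations that
  act on triples. Isometries and trialities, which are given in very different ways, meet in this
  notion.
\<close>

definition correlations :: "(('k::{field,finite} ^ 8) set \<Rightarrow> ('k ^ 8) set) set" where
  "correlations = {g \<in> Bij objects.
     (\<forall>X\<in>objects. \<forall>Y\<in>objects. incident (g X) (g Y) \<longleftrightarrow> incident X Y) \<and>
     (\<forall>\<tau>\<in>object_types. g ` \<tau> \<in> object_types)}"

lemma object_types_iff:
  "\<tau> \<in> object_types \<longleftrightarrow> \<tau> = polar_points \<or> (\<exists>S\<in>solids. \<tau> = same_family `` {S})"
  by (auto simp: object_types_def quotient_def)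

lemma object_type_subset: "\<tau> \<in> object_types \<Longrightarrow> \<tau> \<subseteq> objects"
  by (auto simp: object_types_def objects_def quotient_def same_family_def)

lemma polar_points_not_solids: "X \<in> polar_points \<Longrightarrow> X \<notin> solids"
  by (simp add: polar_points_def solids_def)

lemma correlationD:
  assumes "g \<in> correlations"
  shows "bij_betw g objects objects"
    and "\<tau> \<in> object_types \<Longrightarrow> g ` \<tau> \<in> object_types"
    and "X \<in> objects \<Longrightarrow> Y \<in> objects \<Longrightarrow> incident (g X) (g Y) \<longleftrightarrow> incident X Y"
  using assms by (auto simp: correlations_def Bij_def)

lemma compose_correlations:
  assumes "g \<in> correlations" "h \<in> correlations"
  shows "compose objects g h \<in> correlations"
proof -
  have h: "h X \<in> objects" if "X \<in> objects" for X
    using correlationD(1)[OF assms(2)] that by (auto simp: bij_betw_def)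
  have "compose objects g h ` \<tau> \<in> object_types" if "\<tau> \<in> object_types" for \<tau>
    using correlationD(2)[OF assms(1)] correlationD(2)[OF assms(2) that]
      image_compose_on[OF object_type_subset[OF that]] by metis
  moreover have "incident (compose objects g h X) (compose objects g h Y) \<longleftrightarrow> incident X Y"
    if "X \<in> objects" "Y \<in> objects" for X Y
    using that h correlationD(3)[OF assms(1)] correlationD(3)[OF assms(2)] by (simp add: compose_def)
  moreover have "compose objects g h \<in> Bij objects"
    using assms by (simp add: correlations_def compose_Bij)
  ultimately show ?thesis by (simp add: correlations_def)
qed

lemma correlation_object_types:
  assumes "g \<in> correlations"
  shows "(`) g ` object_types = object_types"
proof (rule endo_inj_surj)
  show "inj_on ((`) g) object_types"
    by (rule inj_on_subset[OF inj_on_image_Pow])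
      (use correlationD(1)[OF assms] object_type_subset in \<open>auto simp: bij_betw_def\<close>)
qed (use correlationD(2)[OF assms] in auto)

lemma incident_triple_subset: "t \<in> incident_triples \<Longrightarrow> t \<subseteq> objects"
  by (simp add: incident_triples_def)

lemma correlation_incident_triples:
  assumes g: "g \<in> correlations" and t: "t \<in> incident_triples"
  shows "g ` t \<in> incident_triples"
proof -
  have t\<O>: "t \<subseteq> objects" by (rule incident_triple_subset[OF t])
  have inj: "inj_on g objects" using correlationD(1)[OF g] by (simp add: bij_betw_def)
  have "card (g ` t \<inter> \<tau>) = 1" if "\<tau> \<in> object_types" for \<tau>
  proof -
    obtain \<tau>' where \<tau>': "\<tau>' \<in> object_types" "\<tau> = g ` \<tau>'"
      using correlation_object_types[OF g] \<open>\<tau> \<in> object_types\<close> by (metis imageE)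
    have "g ` t \<inter> \<tau> = g ` (t \<inter> \<tau>')"
      using inj_on_image_Int[OF inj t\<O> object_type_subset[OF \<tau>'(1)]] \<tau>'(2) by simp
    moreover have "card (g ` (t \<inter> \<tau>')) = card (t \<inter> \<tau>')"
      by (rule card_image) (use inj t\<O> in \<open>auto intro: inj_on_subset\<close>)
    ultimately show ?thesis using t \<tau>'(1) by (simp add: incident_triples_def)
  qed
  moreover have "g ` t \<subseteq> objects"
    using correlationD(1)[OF g] t\<O> by (auto simp: bij_betw_def)
  moreover have "pairwise incident (g ` t)"
  proof (rule pairwiseI)
    fix X Y assume "X \<in> g ` t" "Y \<in> g ` t" "X \<noteq> Y"
    then obtain X' Y' where "X = g X'" "Y = g Y'" "X' \<in> t" "Y' \<in> t" "X' \<noteq> Y'" by blast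
    moreover from this have "incident X' Y'" using t by (auto simp: incident_triples_def pairwise_def)
    ultimately show "incident X Y" using correlationD(3)[OF g] t\<O> by blast
  qed
  ultimately show ?thesis by (simp add: incident_triples_def)
qed

subsection \<open>Isometries\<close>

lemma subgroup_orthogonal_group:
  "subgroup (orthogonal_group :: ('k::{field,finite} ^ 8 \<Rightarrow> 'k ^ 8) set) (BijGroup UNIV)"
proof (rule group.subgroupI[OF group_BijGroup])
  let ?O = "orthogonal_group :: ('k ^ 8 \<Rightarrow> 'k ^ 8) set"
  have Bij: "g \<in> Bij UNIV" if "g \<in> ?O" for g
    using that by (simp add: orthogonal_group_def Bij_def)
  show "?O \<subseteq> carrier (BijGroup UNIV)" using Bij by (auto simp: BijGroup_def)
  show "?O \<noteq> {}"
  proof -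
    have "(\<lambda>v. v) \<in> ?O" by (simp add: orthogonal_group_def vec.linear_ident bij_id[unfolded id_def])
    then show ?thesis by blast
  qed
  fix g assume g: "g \<in> ?O"
  have lin: "Vector_Spaces.linear (*s) (*s) g" and bij: "bij g"
    and form: "\<And>v. hyperbolic_form (g v) = hyperbolic_form v"
    using g by (auto simp: orthogonal_group_def)
  have inv_g: "inv\<^bsub>BijGroup UNIV\<^esub> g = inv_into UNIV g"
    using inv_BijGroup[OF Bij[OF g]] by (simp add: fun_eq_iff)
  have "hyperbolic_form (inv_into UNIV g v) = hyperbolic_form v" for v
    using form[of "inv_into UNIV g v"] bij by (simp add: bij_is_surj surj_f_inv_f)
  then show "inv\<^bsub>BijGroup UNIV\<^esub> g \<in> ?O"
    unfolding inv_g orthogonal_group_def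
    using vec.inj_linear_imp_inv_linear[OF lin bij_is_inj[OF bij]] bij_imp_bij_inv[OF bij] by simp
  fix h assume h: "h \<in> ?O"
  have "g \<otimes>\<^bsub>BijGroup UNIV\<^esub> h = g \<circ> h"
    using Bij[OF g] Bij[OF h] by (simp add: BijGroup_def compose_def fun_eq_iff)
  moreover have "Vector_Spaces.linear (*s) (*s) (g \<circ> h)"
    using h lin by (intro Vector_Spaces.linear_compose) (auto simp: orthogonal_group_def)
  ultimately show "g \<otimes>\<^bsub>BijGroup UNIV\<^esub> h \<in> ?O"
    using h form bij by (auto simp: orthogonal_group_def intro: bij_comp)
qed

lemma Omega_plus_subset: "Omega_plus \<subseteq> orthogonal_group"
  unfolding Omega_plus_def
  by (rule group.derived_incl[OF group_BijGroup subset_refl subgroup_orthogonal_group])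

lemma subgroup_Omega_plus: "subgroup Omega_plus (BijGroup UNIV)"
  unfolding Omega_plus_def
  by (rule group.derived_is_subgroup[OF group_BijGroup])
    (rule subgroup.subset[OF subgroup_orthogonal_group])

lemma isometry_dim:
  assumes "g \<in> orthogonal_group"
  shows "vec.dim (g ` U) = vec.dim U"
  by (rule vec.dim_image_eq) (use assms in \<open>auto simp: orthogonal_group_def bij_def inj_on_def\<close>)

lemma isometry_totally_singular:
  assumes "g \<in> orthogonal_group" "totally_singular U"
  shows "totally_singular (g ` U)"
proof -
  have "Vector_Spaces.linear (*s) (*s) g" using assms(1) by (simp add: orthogonal_group_def)
  then have "vec.subspace (g ` U)"
    using assms(2) by (intro vec.linear_subspace_image) (auto simp: totally_singular_def)
  then show ?thesis using assms by (auto simp: totally_singular_def orthogonal_group_def)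
qed

lemma isometry_objects:
  assumes "g \<in> orthogonal_group"
  shows "X \<in> polar_points \<Longrightarrow> g ` X \<in> polar_points" "X \<in> solids \<Longrightarrow> g ` X \<in> solids"
    and "X \<in> objects \<Longrightarrow> g ` X \<in> objects"
  using isometry_totally_singular[OF assms] isometry_dim[OF assms]
  by (auto simp: polar_points_def solids_def objects_def)

text \<open>
  The type of an object, up to the two families of solids, can be read off its dimension. Isometries
  preserve dimensions, so statements about an object and its image become equivalences without
  recourse to the inverse isometry.
\<close>

lemma object_dim:
  assumes "X \<in> objects"
  shows "X \<in> polar_points \<longleftrightarrow> vec.dim X = 1" "X \<in> solids \<longleftrightarrow> vec.dim X = 4"
  using assms by (auto simp: polar_points_def solids_def objects_def)

lemma isometry_same_family:
  assumes g: "g \<in> orthogonal_group" and "X \<in> objects" "Y \<in> objects"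
  shows "(g ` X, g ` Y) \<in> same_family \<longleftrightarrow> (X, Y) \<in> same_family"
proof -
  have "inj g" using g by (simp add: orthogonal_group_def bij_is_inj)
  moreover have "g ` X \<in> objects" "g ` Y \<in> objects"
    using isometry_objects(3)[OF g] assms(2,3) by auto
  ultimately show ?thesis
    using assms(2,3) by (simp add: same_family_def object_dim(2) isometry_dim[OF g] flip: image_Int)
qed

lemma isometry_incident:
  assumes g: "g \<in> orthogonal_group" and "X \<in> objects" "Y \<in> objects"
  shows "incident (g ` X) (g ` Y) \<longleftrightarrow> incident X Y"
proof -
  have "inj g" using g by (simp add: orthogonal_group_def bij_is_inj)
  moreover have "g ` X \<in> objects" "g ` Y \<in> objects"
    using isometry_objects(3)[OF g] assms(2,3) by auto
  ultimately show ?thesis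
    using assms(2,3)
    by (simp add: incident_def object_dim isometry_dim[OF g] isometry_same_family[OF g]
        inj_image_subset_iff flip: image_Int)
qed

lemma subgroup_POmega_plus: "subgroup POmega_plus (BijGroup objects)"
  unfolding POmega_plus_def
  by (rule set_action_subgroup[OF subgroup_Omega_plus])
    (use isometry_objects(3) Omega_plus_subset in blast)+

lemma POmega_plus_correlations: "POmega_plus \<subseteq> correlations"
proof
  fix f :: "('k::{field,finite} ^ 8) set \<Rightarrow> ('k ^ 8) set"
  assume f: "f \<in> POmega_plus"
  then obtain g where g: "g \<in> orthogonal_group" "f = set_action objects g"
    using Omega_plus_subset by (auto simp: POmega_plus_def)
  have bij: "f \<in> Bij objects"
    using f subgroup.subset[OF subgroup_POmega_plus] by (auto simp: BijGroup_def)
  have fX: "f X = g ` X" if "X \<in> objects" for X using that g(2) by (simp add: set_action_def)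
  have onto: "\<exists>X\<in>objects. Y = g ` X" if "Y \<in> objects" for Y
    using that bij fX by (auto simp: Bij_def bij_betw_def) (metis imageE)
  have "f ` polar_points = polar_points"
  proof
    show "f ` polar_points \<subseteq> polar_points"
      using fX isometry_objects(1)[OF g(1)] by (auto simp: objects_def)
    show "polar_points \<subseteq> f ` polar_points"
    proof
      fix Y :: "('k ^ 8) set" assume Y: "Y \<in> polar_points"
      then have "Y \<in> objects" by (simp add: objects_def)
      then obtain X where "X \<in> objects" "Y = g ` X" using onto by blast
      moreover from this have "X \<in> polar_points"
        using object_dim(1)[of X] object_dim(1)[of Y] \<open>Y \<in> objects\<close> Y isometry_dim[OF g(1), of X] by simp
      ultimately show "Y \<in> f ` polar_points" using fX by blast
    qed
  qed
  moreover have "f ` (same_family `` {S}) = same_family `` {g ` S}" if S: "S \<in> solids" for S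
  proof
    have SO: "S \<in> objects" using S by (simp add: objects_def)
    have dom: "same_family `` {S'} \<subseteq> objects" for S' :: "('k ^ 8) set"
      by (auto simp: same_family_def objects_def)
    show "f ` (same_family `` {S}) \<subseteq> same_family `` {g ` S}"
      using fX dom isometry_same_family[OF g(1) SO] by fastforce
    show "same_family `` {g ` S} \<subseteq> f ` (same_family `` {S})"
    proof
      fix Y assume Y: "Y \<in> same_family `` {g ` S}"
      then obtain X where X: "X \<in> objects" "Y = g ` X" using onto dom by blast
      then have "(S, X) \<in> same_family" using isometry_same_family[OF g(1) SO] Y by simp
      then show "Y \<in> f ` (same_family `` {S})" using X fX by blast
    qed
  qed
  ultimately have "f ` \<tau> \<in> object_types" if "\<tau> \<in> object_types" for \<tau>
    using that isometry_objects(2)[OF g(1)] unfolding object_types_iff by metis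
  then show "f \<in> correlations"
    using bij fX isometry_incident[OF g(1)] by (simp add: correlations_def)
qed

subsection \<open>Triality\<close>

lemma triality_group_correlations:
  assumes "triality_group T"
  shows "T \<subseteq> correlations"
proof
  fix t assume t: "t \<in> T"
  have "t \<in> Bij objects"
    using assms t subgroup.subset[of T "BijGroup objects"] by (auto simp: triality_group_def BijGroup_def)
  moreover have "set_action object_types t \<in> Bij object_types"
    using assms t by (auto simp: triality_group_def iso_def hom_def BijGroup_def)
  then have "t ` \<tau> \<in> object_types" if "\<tau> \<in> object_types" for \<tau>
    using funcset_mem[OF Bij_imp_funcset that, of "set_action object_types t"] that
    by (simp add: set_action_def)
  ultimately show "t \<in> correlations"
    using assms t by (auto simp: triality_group_def correlations_def)
qed

text \<open>
  This is where the triality group has to normalize \<open>POmega_plus\<close>: the product of the two groups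
  lies in the normalizer, in which \<open>POmega_plus\<close> is normal.
\<close>

lemma subgroup_POmega_plus_ext:
  assumes "triality_group T"
  shows "subgroup (POmega_plus_ext T) (BijGroup objects)"
proof -
  interpret group "BijGroup (objects :: ('a ^ 8) set set)" by (rule group_BijGroup)
  let ?K = "normalizer (BijGroup objects) (POmega_plus :: (('a ^ 8) set \<Rightarrow> _) set)"
  have K: "subgroup ?K (BijGroup objects)"
    by (rule normalizer_imp_subgroup[OF subgroup.subset[OF subgroup_POmega_plus]])
  have "subgroup T ((BijGroup objects)\<lparr>carrier := ?K\<rparr>)"
    using assms by (intro subgroup_incl K) (auto simp: triality_group_def)
  then have "subgroup (POmega_plus_ext T) ((BijGroup objects)\<lparr>carrier := ?K\<rparr>)"
    unfolding POmega_plus_ext_def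
    by (rule mult_norm_sub_in_sub[OF subgroup_in_normalizer[OF subgroup_POmega_plus] _ K])
  then show ?thesis by (rule incl_subgroup[OF K])
qed

lemma POmega_plus_ext_correlations:
  assumes "triality_group T"
  shows "POmega_plus_ext T \<subseteq> correlations"
proof
  fix f assume "f \<in> POmega_plus_ext T"
  then obtain g t where gt: "g \<in> POmega_plus" "t \<in> T" "f = g \<otimes>\<^bsub>BijGroup objects\<^esub> t"
    by (auto simp: POmega_plus_ext_def set_mult_def)
  have corr: "g \<in> correlations" "t \<in> correlations"
    using gt POmega_plus_correlations triality_group_correlations[OF assms] by auto
  then have "f = compose objects g t" using gt(3) by (simp add: BijGroup_def correlations_def)
  then show "f \<in> correlations" using compose_correlations[OF corr] by simp
qed

lemma triality_group_subset_ext: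
  assumes "triality_group T"
  shows "T \<subseteq> POmega_plus_ext T"
proof
  fix t assume t: "t \<in> T"
  interpret group "BijGroup (objects :: ('a ^ 8) set set)" by (rule group_BijGroup)
  have "t \<in> carrier (BijGroup objects)"
    using assms t subgroup.subset[of T "BijGroup objects"] by (auto simp: triality_group_def)
  then have "t = \<one>\<^bsub>BijGroup objects\<^esub> \<otimes>\<^bsub>BijGroup objects\<^esub> t" by simp
  then show "t \<in> POmega_plus_ext T"
    using t subgroup.one_closed[OF subgroup_POmega_plus] unfolding POmega_plus_ext_def set_mult_def
    by blast
qed

text \<open>
  A triality group induces every permutation of the types, in particular the transposition of the
  points with a given type.
\<close>

lemma triality_group_moves_points:
  fixes T :: "(('k::{field,finite} ^ 8) set \<Rightarrow> ('k ^ 8) set) set"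
  assumes "triality_group T" "\<tau> \<in> object_types"
  obtains t where "t \<in> T" "t ` polar_points = \<tau>"
proof -
  let ?swap = "\<lambda>\<upsilon>. if \<upsilon> = polar_points then \<tau> else if \<upsilon> = \<tau> then polar_points else \<upsilon>"
  define \<pi> where "\<pi> = (\<lambda>\<upsilon>\<in>object_types. ?swap \<upsilon>)"
  have P: "(polar_points :: ('k ^ 8) set set) \<in> object_types" by (simp add: object_types_def)
  have "bij_betw ?swap object_types object_types"
    using P assms(2) by (intro bij_betwI[where g = ?swap]) auto
  then have "\<pi> \<in> carrier (BijGroup object_types)"
    by (simp add: BijGroup_def Bij_def \<pi>_def)
  moreover have "set_action object_types ` T = carrier (BijGroup object_types)"
    using assms(1) by (simp add: triality_group_def iso_def bij_betw_def)
  ultimately have "\<pi> \<in> set_action object_types ` T" by simp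
  then obtain t where t: "\<pi> = set_action object_types t" "t \<in> T" by (rule imageE)
  have "t ` polar_points = \<pi> polar_points" unfolding t(1) using P by (simp add: set_action_def)
  also have "\<dots> = \<tau>" using P by (simp add: \<pi>_def)
  finally show thesis using that t(2) by blast
qed

text \<open>
  That each family of solids is met exactly once amounts to \<open>solid_meets_one_more\<close>, applied to a
  solid that represents the family.
\<close>

lemma coordinate_triple:
  assumes i: "i \<in> {0, 2}"
  shows "{coordinate_subspace {i}, solid6, solid7} \<in> (incident_triples :: ('k::{field,finite} ^ 8) set set set)"
proof -
  let ?p = "coordinate_subspace {i} :: ('k ^ 8) set" and ?t = "{coordinate_subspace {i}, solid6, solid7 :: ('k ^ 8) set}"
  have p: "?p \<in> polar_points" "?p \<notin> solids"
    using i coordinate_points polar_points_not_solids by auto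
  have s: "(solid6 :: ('k ^ 8) set) \<notin> polar_points" "(solid7 :: ('k ^ 8) set) \<notin> polar_points"
    using coordinate_solids polar_points_not_solids by auto
  have "?t \<inter> polar_points = {?p}" using p s by auto
  moreover have "card (?t \<inter> same_family `` {S}) = 1" if "S \<in> solids" for S
  proof -
    have "?p \<notin> same_family `` {S}" using p by (simp add: same_family_def)
    then have "?t \<inter> same_family `` {S} = {solid6} \<or> ?t \<inter> same_family `` {S} = {solid7}"
      using solid_meets_one_more[OF that] that coordinate_solids by (auto simp: same_family_def)
    then show ?thesis by auto
  qed
  ultimately have "\<forall>\<tau>\<in>object_types. card (?t \<inter> \<tau>) = 1"
    by (auto simp: object_types_def quotient_def)
  moreover have "?t \<subseteq> objects" using p coordinate_solids by (auto simp: objects_def)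
  moreover have "pairwise incident ?t"
  proof -
    have "?p \<subseteq> solid6" "?p \<subseteq> solid7" using i by (intro coordinate_subspace_mono; auto)+
    moreover have "vec.dim (solid6 \<inter> solid7 :: ('k ^ 8) set) = 3"
      by (simp add: coordinate_subspace_Int dim_coordinate_subspace)
    ultimately show ?thesis
      using p(1) coordinate_solids
      by (auto simp: pairwise_insert incident_def same_family_def Int_commute)
  qed
  ultimately show ?thesis by (simp add: incident_triples_def)
qed

text \<open>
  The two triples of the base edge have the same solids and different points, so only the
  partition by points splits it. An element of the triality group that carries points to solids
  moves this partition.
\<close>

proposition triality_not_road_closure:
  fixes T :: "(('k::{field,finite} ^ 8) set \<Rightarrow> ('k ^ 8) set) set"
  assumes T: "triality_group T"
  shows "\<not> road_closure_property (set_action incident_triples ` POmega_plus_ext T) incident_triples"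
proof -
  let ?\<Omega> = "incident_triples :: ('k ^ 8) set set set"
  have ext: "POmega_plus_ext T \<subseteq> correlations" by (rule POmega_plus_ext_correlations[OF T])
  have G: "subgroup (set_action ?\<Omega> ` POmega_plus_ext T) (BijGroup ?\<Omega>)"
    by (rule set_action_subgroup[OF subgroup_POmega_plus_ext[OF T] incident_triple_subset])
      (use ext correlation_incident_triples in blast)+
  define same where "same \<tau> = fibres ?\<Omega> (\<lambda>t. t \<inter> \<tau>)" for \<tau> :: "('k ^ 8) set set"
  have image_same: "(`) (set_action ?\<Omega> g) ` same \<tau> = same (g ` \<tau>)"
    if g: "g \<in> POmega_plus_ext T" and \<tau>: "\<tau> \<in> object_types" for g \<tau>
    unfolding same_def
  proof (rule image_fibres)
    show "bij_betw (set_action ?\<Omega> g) ?\<Omega> ?\<Omega>" using perm_group_bij[OF G] g by blast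
    fix t u :: "('k ^ 8) set set" assume t: "t \<in> ?\<Omega>" and u: "u \<in> ?\<Omega>"
    have inj: "inj_on g objects" using correlationD(1) ext g by (auto simp: bij_betw_def)
    have "g ` t \<inter> g ` \<tau> = g ` u \<inter> g ` \<tau> \<longleftrightarrow> g ` (t \<inter> \<tau>) = g ` (u \<inter> \<tau>)"
      using inj_on_image_Int[OF inj incident_triple_subset object_type_subset[OF \<tau>]] t u by simp
    also have "\<dots> \<longleftrightarrow> t \<inter> \<tau> = u \<inter> \<tau>"
      by (rule inj_on_image_eq_iff[OF inj]) (use object_type_subset[OF \<tau>] in auto)
    finally show "set_action ?\<Omega> g t \<inter> g ` \<tau> = set_action ?\<Omega> g u \<inter> g ` \<tau> \<longleftrightarrow> t \<inter> \<tau> = u \<inter> \<tau>"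
      using t u by (simp add: set_action_def)
  qed
  let ?p = "\<lambda>i. coordinate_subspace {i} :: ('k ^ 8) set"
  define t0 where "t0 = {?p 0, solid6, solid7}"
  define t2 where "t2 = {?p 2, solid6, solid7}"
  have t: "t0 \<in> ?\<Omega>" "t2 \<in> ?\<Omega>" unfolding t0_def t2_def by (rule coordinate_triple; simp)+
  have points: "?p 0 \<in> polar_points" "?p 2 \<in> polar_points" by (rule coordinate_points)+
  have not_points: "solid6 \<notin> (polar_points :: ('k ^ 8) set set)" "solid7 \<notin> (polar_points :: ('k ^ 8) set set)"
    using coordinate_solids polar_points_not_solids by auto
  have "?p 0 \<noteq> ?p 2"
  proof
    assume eq: "?p 0 = ?p 2"
    have "vec.dim (?p 0 \<inter> ?p 2) = 1" unfolding eq by (simp add: dim_coordinate_subspace)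
    moreover have "vec.dim (?p 0 \<inter> ?p 2) = 0"
      by (simp add: coordinate_subspace_Int dim_coordinate_subspace)
    ultimately show False by simp
  qed
  then have points_differ: "t0 \<inter> polar_points \<noteq> t2 \<inter> polar_points"
    using points not_points by (auto simp: t0_def t2_def)
  have solids_agree: "t0 \<inter> \<tau> = t2 \<inter> \<tau>" if "\<tau> \<in> object_types" "\<tau> \<noteq> polar_points" for \<tau>
  proof -
    have "\<tau> \<subseteq> solids" using that by (auto simp: object_types_def quotient_def same_family_def)
    then have "?p 0 \<notin> \<tau>" "?p 2 \<notin> \<tau>" using points polar_points_not_solids by auto
    then show ?thesis by (auto simp: t0_def t2_def)
  qed
  have splits_same: "splits (same \<tau>) {t0, t2} \<longleftrightarrow> \<tau> = polar_points" if "\<tau> \<in> object_types" for \<tau>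
    unfolding same_def splits_fibres[OF t] using points_differ solids_agree[OF that] by auto
  have polar_type: "polar_points \<in> object_types" by (simp add: object_types_def)
  define \<tau> where "\<tau> = same_family `` {solid6 :: ('k ^ 8) set}"
  have \<tau>: "\<tau> \<in> object_types" "\<tau> \<noteq> polar_points"
  proof -
    show "\<tau> \<in> object_types"
      using coordinate_solids(1) by (auto simp: \<tau>_def object_types_def quotient_def)
    have "\<tau> \<subseteq> solids" by (auto simp: \<tau>_def same_family_def)
    then show "\<tau> \<noteq> polar_points" using points(1) polar_points_not_solids by auto
  qed
  obtain g where g: "g \<in> T" "g ` polar_points = \<tau>"
    using triality_group_moves_points[OF T \<tau>(1)] .
  then have g_ext: "g \<in> POmega_plus_ext T" using triality_group_subset_ext[OF T] by blast
  have moved: "(`) (set_action ?\<Omega> g) ` same polar_points \<noteq> same polar_points"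
    using image_same[OF g_ext polar_type] g(2) splits_same[OF polar_type] splits_same[OF \<tau>(1)] \<tau>(2) by metis
  show ?thesis
  proof (rule not_road_closure_if_split_once[OF _ G, where \<P> = "same ` object_types"])
    show "finite ?\<Omega>" by simp
    show "partition_on ?\<Omega> P" if "P \<in> same ` object_types" for P
      using that by (auto simp: same_def partition_on_fibres)
    show "(`) \<gamma> ` P \<in> same ` object_types"
      if \<gamma>: "\<gamma> \<in> set_action ?\<Omega> ` POmega_plus_ext T" and P: "P \<in> same ` object_types" for \<gamma> P
    proof -
      obtain f where f: "\<gamma> = set_action ?\<Omega> f" "f \<in> POmega_plus_ext T" using \<gamma> by (rule imageE)
      obtain \<upsilon> where \<upsilon>: "P = same \<upsilon>" "\<upsilon> \<in> object_types" using P by (rule imageE)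
      have "f ` \<upsilon> \<in> object_types" using correlationD(2) ext f(2) \<upsilon>(2) by blast
      then show ?thesis unfolding f(1) \<upsilon>(1) image_same[OF f(2) \<upsilon>(2)] by (rule imageI)
    qed
    show "{t0, t2} \<in> two_subsets ?\<Omega>" using t points_differ by (auto simp: two_subsets_def card_2_iff)
    show "same polar_points \<in> same ` object_types" using polar_type by blast
    show "splits (same polar_points) {t0, t2}" using splits_same[OF polar_type] by simp
    show "P = same polar_points" if "P \<in> same ` object_types" "splits P {t0, t2}" for P
      using that splits_same by auto
    show "set_action ?\<Omega> g \<in> set_action ?\<Omega> ` POmega_plus_ext T" using g_ext by blast
  qed (rule moved)
qed

section \<open>The four classes of groups\<close>

theorem theorem1p4:
  shows
    "(\<forall>(\<Omega> :: 'a set) G.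
        finite \<Omega> \<and> subgroup G (BijGroup \<Omega>) \<and> imprimitive_on G \<Omega> \<longrightarrow>
        \<not> road_closure_property G \<Omega>) \<and>
     (\<forall>(\<Omega> :: 'a set) G.
        finite \<Omega> \<and> subgroup G (BijGroup \<Omega>) \<and> primitive_on G \<Omega> \<and> \<not> basic_on G \<Omega> \<longrightarrow>
        \<not> road_closure_property G \<Omega>) \<and>
     (\<forall>(\<Omega> :: 'a set) G N.
        finite \<Omega> \<and> subgroup G (BijGroup \<Omega>) \<and> primitive_on G \<Omega> \<and>
        N \<lhd> perm_group G \<Omega> \<and> card (rcosets\<^bsub>perm_group G \<Omega>\<^esub> N) = 2 \<and> imprimitive_on N \<Omega> \<longrightarrow>
        \<not> road_closure_property G \<Omega>) \<and>
     (\<forall>T :: (('k::{field,finite} ^ 8) set \<Rightarrow> ('k ^ 8) set) set.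
        triality_group T \<longrightarrow>
        \<not> road_closure_property
            (set_action incident_triples ` POmega_plus_ext T) incident_triples)"
proof (intro conjI allI impI; (elim conjE)?)
  show "\<not> road_closure_property G \<Omega>"
    if "finite \<Omega>" "subgroup G (BijGroup \<Omega>)" "imprimitive_on G \<Omega>" for \<Omega> :: "'a set" and G
    using that by (rule imprimitive_not_road_closure)
  show "\<not> road_closure_property G \<Omega>"
    if "finite \<Omega>" "subgroup G (BijGroup \<Omega>)" "primitive_on G \<Omega>" "\<not> basic_on G \<Omega>"
    for \<Omega> :: "'a set" and G
    using that by (rule nonbasic_not_road_closure)
  show "\<not> road_closure_property G \<Omega>"
    if "finite \<Omega>" "subgroup G (BijGroup \<Omega>)" "primitive_on G \<Omega>" "N \<lhd> perm_group G \<Omega>"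
      "card (rcosets\<^bsub>perm_group G \<Omega>\<^esub> N) = 2" "imprimitive_on N \<Omega>"
    for \<Omega> :: "'a set" and G N
    using that by (rule index_two_not_road_closure)
  show "\<not> road_closure_property (set_action incident_triples ` POmega_plus_ext T) incident_triples"
    if "triality_group T" for T :: "(('k::{field,finite} ^ 8) set \<Rightarrow> ('k ^ 8) set) set"
    using that by (rule triality_not_road_closure)
qed

end
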